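(* Let $d\ge 3$ be a fixed integer. Then there exists $c=c(d)>0$ such that a uniformly random $d$-regular graph $G\sim G_{n,d}$ on $[n]$ satisfies $\mu(G)\ge 2^{cn}$ whp.
   Context: For a finite graph $G$, $\mu(G)$ denotes the number of pairwise non-isomorphic induced subgraphs of $G$, i.e. the number of isomorphism classes among the graphs $G[U]$, $U\subset V(G)$. $G_{n,d}$ is the uniform distribution on the set of all (simple, labelled) $d$-regular graphs on vertex set $[n]=\{1,\dots,n\}$, where $dn$ is even. "Whp" means with probability tending to $1$ as $n\to\infty$ (along those $n$ for which $dn$ is even), with $d$ fixed. *)

theory Defs
  imports "HOL-Probability.Probability"
begin

type_synonym 'a ugraph = "'a set \<times> 'a set set"

abbreviation verts :: "'a ugraph \<Rightarrow> 'a set" where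
  "verts G \<equiv> fst G"

abbreviation edges :: "'a ugraph \<Rightarrow> 'a set set" where
  "edges G \<equiv> snd G"

definition simple_graph :: "'a ugraph \<Rightarrow> bool" where
  "simple_graph G \<longleftrightarrow> finite (verts G) \<and> (\<forall>e\<in>edges G. e \<subseteq> verts G \<and> card e = 2)"

definition graph_degree :: "'a ugraph \<Rightarrow> 'a \<Rightarrow> nat" where
  "graph_degree G v = card {e \<in> edges G. v \<in> e}"

definition regular :: "nat \<Rightarrow> 'a ugraph \<Rightarrow> bool" where
  "regular d G \<longleftrightarrow> (\<forall>v\<in>verts G. graph_degree G v = d)"

definition induced :: "'a ugraph \<Rightarrow> 'a set \<Rightarrow> 'a ugraph" where
  "induced G U = (U, {e \<in> edges G. e \<subseteq> U})"

definition graph_iso :: "'a ugraph \<Rightarrow> 'b ugraph \<Rightarrow> bool" where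
  "graph_iso G H \<longleftrightarrow> (\<exists>f. bij_betw f (verts G) (verts H) \<and>
     (\<forall>u\<in>verts G. \<forall>v\<in>verts G. {u, v} \<in> edges G \<longleftrightarrow> {f u, f v} \<in> edges H))"

definition induced_subgraphs :: "'a ugraph \<Rightarrow> 'a ugraph set" where
  "induced_subgraphs G = induced G ` Pow (verts G)"

definition iso_rel :: "'a ugraph set \<Rightarrow> ('a ugraph \<times> 'a ugraph) set" where
  "iso_rel S = {(G, H). G \<in> S \<and> H \<in> S \<and> graph_iso G H}"

definition mu :: "'a ugraph \<Rightarrow> nat" where
  "mu G = card (induced_subgraphs G // iso_rel (induced_subgraphs G))"

lemma equiv_iso_rel: "equiv S (iso_rel S)"
proof (rule equivI)
  show "refl_on S (iso_rel S)"
    by (auto simp: refl_on_def iso_rel_def graph_iso_def intro!: exI[of _ id])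
  show "iso_rel S \<subseteq> S \<times> S"
    by (auto simp: iso_rel_def)
  show "sym (iso_rel S)"
  proof (rule symI)
    fix G H assume "(G, H) \<in> iso_rel S"
    then obtain f where S: "G \<in> S" "H \<in> S" and f: "bij_betw f (verts G) (verts H)"
      and e: "\<forall>u\<in>verts G. \<forall>v\<in>verts G. {u, v} \<in> edges G \<longleftrightarrow> {f u, f v} \<in> edges H"
      by (auto simp: iso_rel_def graph_iso_def)
    let ?g = "inv_into (verts G) f"
    have "bij_betw ?g (verts H) (verts G)"
      using f by (rule bij_betw_inv_into)
    moreover have "\<forall>u\<in>verts H. \<forall>v\<in>verts H. {u, v} \<in> edges H \<longleftrightarrow> {?g u, ?g v} \<in> edges G"
      using e f bij_betw_inv_into_right[OF f] bij_betwE[OF bij_betw_inv_into[OF f]] by simp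
    ultimately show "(H, G) \<in> iso_rel S"
      using S by (auto simp: iso_rel_def graph_iso_def)
  qed
  show "trans (iso_rel S)"
  proof (rule transI)
    fix G H K assume "(G, H) \<in> iso_rel S" "(H, K) \<in> iso_rel S"
    then obtain f g where S: "G \<in> S" "K \<in> S"
      and f: "bij_betw f (verts G) (verts H)" and g: "bij_betw g (verts H) (verts K)"
      and ef: "\<forall>u\<in>verts G. \<forall>v\<in>verts G. {u, v} \<in> edges G \<longleftrightarrow> {f u, f v} \<in> edges H"
      and eg: "\<forall>u\<in>verts H. \<forall>v\<in>verts H. {u, v} \<in> edges H \<longleftrightarrow> {g u, g v} \<in> edges K"
      by (auto simp: iso_rel_def graph_iso_def)
    have "bij_betw (g \<circ> f) (verts G) (verts K)"
      using f g by (rule bij_betw_trans)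
    moreover have "\<forall>u\<in>verts G. \<forall>v\<in>verts G. {u, v} \<in> edges G \<longleftrightarrow> {(g \<circ> f) u, (g \<circ> f) v} \<in> edges K"
      using ef eg bij_betwE[OF f] by simp
    ultimately show "(G, K) \<in> iso_rel S"
      using S unfolding iso_rel_def graph_iso_def by blast
  qed
qed

definition regular_graphs :: "nat \<Rightarrow> nat \<Rightarrow> nat ugraph set" where
  "regular_graphs n d = {G. simple_graph G \<and> verts G = {1..n} \<and> regular d G}"

lemma finite_regular_graphs: "finite (regular_graphs n d)"
proof (rule finite_subset)
  show "regular_graphs n d \<subseteq> {{1..n}} \<times> Pow (Pow {1..n})"
    by (force simp: regular_graphs_def simple_graph_def)
qed simp

(* pmf_of_set is meaningful only on nonempty sets; regular_graphs n d is nonempty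
   whenever d * n is even and n > d, so the finitely many remaining even cases do
   not affect limits. *)
definition random_regular_graph :: "nat \<Rightarrow> nat \<Rightarrow> nat ugraph pmf" where
  "random_regular_graph n d = pmf_of_set (regular_graphs n d)"

definition whp_regular :: "nat \<Rightarrow> (nat \<Rightarrow> nat ugraph \<Rightarrow> bool) \<Rightarrow> bool" where
  "whp_regular d P \<longleftrightarrow>
     ((\<lambda>n. measure_pmf.prob (random_regular_graph n d) {G. P n G}) \<longlongrightarrow> 1)
       (inf sequentially (principal {n. even (d * n)}))"

end

theory Submission
  imports Defs "HOL-Combinatorics.Orbits" "HOL-Real_Asymp.Real_Asymp"
begin

text \<open>
  The proof is a compression argument: a graph with the wrong structure can be described by
  fewer than the \<open>d * n / 2\<close> vertex labels needed for a typical \<open>d\<close>-regular graph. Up to factors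
  exponential in \<open>n\<close> there are \<open>n ^ (d * n / 2)\<close> such graphs, so saving \<open>\<eta> * n\<close> labels, i.e. a factor
  \<open>n ^ (\<eta> * n)\<close>, shows that the graphs in question form a vanishing fraction.

  Take a linear-size set \<open>T\<close> of pairwise far apart vertices lying in no triangle, and consider the induced
  subgraphs \<open>G - W\<close> with \<open>W \<subseteq> T\<close>. If no isomorphism \<open>f\<close> between two of them moves more than
  \<open>\<epsilon> * n\<close> vertices, then isomorphic \<open>G - W\<close> and \<open>G - W'\<close> have \<open>W\<close> and \<open>W'\<close> close in Hamming distance,
  so exponentially many of the \<open>2 ^ card T\<close> subgraphs are pairwise non-isomorphic.
  If some \<open>f\<close> moves a set \<open>M\<close> of many vertices, record \<open>f\<close> on \<open>M\<close>, leaving out one vertex per cycle, and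
  one edge of \<open>G\<close> per \<open>f\<close>-orbit. Since \<open>d \<ge> 3\<close>, the edges touching \<open>M\<close> outnumber \<open>M\<close> by a constant
  factor, so this saves linearly many labels. Graphs with many triangles are compressed directly:
  two labels describe the three edges of a triangle.
\<close>

subsection \<open>Counting small sets and codes\<close>

lemma sum_Pow_power:
  fixes x :: real
  assumes "finite P"
  shows "(\<Sum>D\<in>Pow P. x ^ card D) = (1 + x) ^ card P"
  using assms
proof (induction P rule: finite_induct)
  case (insert a P)
  have "(\<Sum>D\<in>Pow (insert a P). x ^ card D)
      = (\<Sum>D\<in>Pow P. x ^ card D) + (\<Sum>D\<in>insert a ` Pow P. x ^ card D)"
    unfolding Pow_insert using insert by (intro sum.union_disjoint) auto
  also have "(\<Sum>D\<in>insert a ` Pow P. x ^ card D) = (\<Sum>D\<in>Pow P. x ^ card (insert a D))"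
    using insert by (subst sum.reindex) (auto simp: inj_on_def)
  also have "\<dots> = (\<Sum>D\<in>Pow P. x * x ^ card D)"
    using insert by (intro sum.cong refl) (auto simp: card_insert_if finite_subset)
  finally show ?case using insert by (simp add: sum_distrib_left[symmetric] algebra_simps)
qed simp

text \<open>Weight each subset by \<open>x ^ card D\<close>: the small ones weigh at least
  \<open>x ^ q\<close> each because \<open>x \<le> 1\<close>, and all subsets together weigh
  \<open>(1 + x) ^ card P\<close>.\<close>

lemma card_small_subsets_le:
  fixes x :: real
  assumes "finite P" "0 < x" "x \<le> 1"
  shows "real (card {D. D \<subseteq> P \<and> card D \<le> q}) * x ^ q \<le> (1 + x) ^ card P"
proof -
  have "real (card {D. D \<subseteq> P \<and> card D \<le> q}) * x ^ q = (\<Sum>D\<in>{D. D \<subseteq> P \<and> card D \<le> q}. x ^ q)"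
    by simp
  also have "\<dots> \<le> (\<Sum>D\<in>{D. D \<subseteq> P \<and> card D \<le> q}. x ^ card D)"
    using assms by (intro sum_mono power_decreasing) auto
  also have "\<dots> \<le> (\<Sum>D\<in>Pow P. x ^ card D)"
    using assms by (intro sum_mono2) auto
  also have "\<dots> = (1 + x) ^ card P" using assms by (simp add: sum_Pow_power)
  finally show ?thesis .
qed

text \<open>Choose \<open>x = 1 / n\<close> above. An unordered set of vertex pairs thus costs one
  factor \<open>n\<close> per pair, not the two that listing both ends would cost; the whole
  accounting in labels rests on this.\<close>

lemma card_small_subsets_le_power_exp:
  assumes "finite P" "n \<ge> 1" "card P \<le> n\<^sup>2"
  shows "real (card {D. D \<subseteq> P \<and> card D \<le> q}) \<le> real n ^ q * exp (real n)"
proof -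
  let ?x = "1 / real n"
  have "(1 + ?x) ^ card P \<le> (1 + ?x) ^ (n\<^sup>2)"
    using assms by (intro power_increasing) auto
  also have "\<dots> \<le> exp ?x ^ (n\<^sup>2)"
    using assms by (intro power_mono) (auto intro: add_increasing)
  also have "\<dots> = exp (real n)"
    using assms by (simp flip: exp_of_nat_mult add: power2_eq_square)
  finally have "real (card {D. D \<subseteq> P \<and> card D \<le> q}) * ?x ^ q \<le> exp (real n)"
    using card_small_subsets_le[of P ?x q] assms by simp
  then show ?thesis using assms by (simp add: field_simps power_divide)
qed

text \<open>Common form of both codes below: \<open>I\<close> is meant for data with only
  exponentially many values, \<open>H i\<close> costs \<open>h i\<close> labels, and
  \<open>D\<close> costs one label per pair. Only the total label budget \<open>K\<close> enters the
  bound.\<close>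

lemma card_codes_le:
  assumes "finite I" "\<And>i. i \<in> I \<Longrightarrow> finite (H i) \<and> card (H i) \<le> n ^ h i"
    and "finite P" "n \<ge> 1" "card P \<le> n\<^sup>2"
  shows "finite (SIGMA i:I. H i \<times> {D. D \<subseteq> P \<and> h i + card D \<le> K})"
    and "real (card (SIGMA i:I. H i \<times> {D. D \<subseteq> P \<and> h i + card D \<le> K}))
      \<le> real (card I) * real n ^ K * exp (real n)"
proof -
  have fin: "finite {D. D \<subseteq> P \<and> h i + card D \<le> K}" for i using assms by auto
  show "finite (SIGMA i:I. H i \<times> {D. D \<subseteq> P \<and> h i + card D \<le> K})"
    using assms fin by auto
  have "real (card (H i \<times> {D. D \<subseteq> P \<and> h i + card D \<le> K})) \<le> real n ^ K * exp (real n)"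
    if i: "i \<in> I" for i
  proof (cases "h i \<le> K")
    case True
    then have eq: "{D. D \<subseteq> P \<and> h i + card D \<le> K} = {D. D \<subseteq> P \<and> card D \<le> K - h i}" by auto
    have "real (card (H i)) * real (card {D. D \<subseteq> P \<and> card D \<le> K - h i})
        \<le> real n ^ h i * (real n ^ (K - h i) * exp (real n))"
      using assms(2)[OF i] assms card_small_subsets_le_power_exp[of P n "K - h i"]
      by (intro mult_mono) (auto simp flip: of_nat_power)
    also have "\<dots> = real n ^ K * exp (real n)"
      using True by (simp flip: mult.assoc power_add)
    finally show ?thesis unfolding eq card_cartesian_product by simp
  next
    case False
    then have eq: "{D. D \<subseteq> P \<and> h i + card D \<le> K} = {}" by auto
    show ?thesis unfolding eq by simp
  qed
  then have "(\<Sum>i\<in>I. real (card (H i \<times> {D. D \<subseteq> P \<and> h i + card D \<le> K})))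
      \<le> (\<Sum>i\<in>I. real n ^ K * exp (real n))"
    by (intro sum_mono)
  then show "real (card (SIGMA i:I. H i \<times> {D. D \<subseteq> P \<and> h i + card D \<le> K}))
      \<le> real (card I) * real n ^ K * exp (real n)"
    using assms fin by (subst card_SigmaI) auto
qed

text \<open>Greedy selection: keep a point, discard it together with its at most \<open>k\<close>
  neighbours, and repeat. Symmetry of \<open>N\<close> protects the kept point from later
  choices.\<close>

lemma ex_independent_subset:
  assumes "finite A" "\<And>x. x \<in> A \<Longrightarrow> finite (N x) \<and> card (N x) \<le> k"
    and "\<And>x y. x \<in> A \<Longrightarrow> y \<in> A \<Longrightarrow> y \<in> N x \<Longrightarrow> x \<in> N y"
  shows "\<exists>T\<subseteq>A. (\<forall>x\<in>T. \<forall>y\<in>T. x \<noteq> y \<longrightarrow> y \<notin> N x) \<and> card A \<le> (k + 1) * card T"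
  using assms
proof (induction "card A" arbitrary: A rule: less_induct)
  case less
  show ?case
  proof (cases "A = {}")
    case False
    then obtain x where x: "x \<in> A" by auto
    define A' where "A' = A - insert x (N x)"
    have "A' \<subset> A" using x by (auto simp: A'_def)
    then have "card A' < card A" using less.prems by (simp add: psubset_card_mono)
    then have "\<exists>T\<subseteq>A'. (\<forall>x\<in>T. \<forall>y\<in>T. x \<noteq> y \<longrightarrow> y \<notin> N x) \<and> card A' \<le> (k + 1) * card T"
    proof (rule less.hyps)
      show "finite A'" using less.prems(1) by (simp add: A'_def)
      show "finite (N x) \<and> card (N x) \<le> k" if "x \<in> A'" for x
        using less.prems(2)[of x] that by (simp add: A'_def)
      show "x \<in> N y" if "x \<in> A'" "y \<in> A'" "y \<in> N x" for x y
        using less.prems(3)[of x y] that by (simp add: A'_def)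
    qed
    then obtain T where T: "T \<subseteq> A'" "\<forall>x\<in>T. \<forall>y\<in>T. x \<noteq> y \<longrightarrow> y \<notin> N x"
        "card A' \<le> (k + 1) * card T"
      by blast
    have fT: "finite T" using T less.prems by (auto simp: A'_def intro: finite_subset)
    have "card A \<le> card A' + card (insert x (N x))"
    proof -
      have "A \<subseteq> A' \<union> insert x (N x)" by (auto simp: A'_def)
      then have "card A \<le> card (A' \<union> insert x (N x))"
        using less.prems x by (intro card_mono) (auto simp: A'_def)
      then show ?thesis using card_Un_le le_trans by blast
    qed
    also have "card (insert x (N x)) \<le> k + 1"
      using less.prems(2)[OF x] card_insert_le_m1[of "k+1" "N x" x] by simp
    finally have "card A \<le> (k + 1) * card (insert x T)"
      using T fT x by (subst card_insert_disjoint) (auto simp: A'_def)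
    moreover have "\<forall>y\<in>insert x T. \<forall>z\<in>insert x T. y \<noteq> z \<longrightarrow> z \<notin> N y"
    proof (intro ballI impI)
      fix y z assume yz: "y \<in> insert x T" "z \<in> insert x T" "y \<noteq> z"
      show "z \<notin> N y"
      proof (cases "y = x \<or> z = x")
        case False then show ?thesis using yz T by auto
      next
        case True
        then have "y = x \<and> z \<in> A' \<or> z = x \<and> y \<in> A'" using yz T by auto
        then show ?thesis using less.prems(3)[of y z] x unfolding A'_def by blast
      qed
    qed
    ultimately show ?thesis using T x by (intro exI[of _ "insert x T"]) (auto simp: A'_def)
  qed simp
qed

subsection \<open>Neighbourhoods in regular graphs\<close>

definition nbrs :: "'a set set \<Rightarrow> 'a \<Rightarrow> 'a set" where
  "nbrs E v = {u. {v, u} \<in> E}"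

text \<open>Ends of walks of one, two or three steps. A vertex with a neighbour is near itself by
  stepping back, hence the proviso \<open>x \<noteq> y\<close> wherever far-apart sets
  occur.\<close>

definition near :: "'a set set \<Rightarrow> 'a \<Rightarrow> 'a set" where
  "near E x = nbrs E x \<union> (\<Union>y\<in>nbrs E x. nbrs E y) \<union> (\<Union>y\<in>nbrs E x. \<Union>z\<in>nbrs E y. nbrs E z)"

lemma nbrs_sym: "u \<in> nbrs E v \<longleftrightarrow> v \<in> nbrs E u"
  by (simp add: nbrs_def insert_commute)

lemma near_sym: "y \<in> near E x \<Longrightarrow> x \<in> near E y"
  unfolding near_def nbrs_def by (auto simp: insert_commute; metis insert_commute)

lemma edges_at_eq_image_nbrs:
  assumes "\<And>e. e \<in> E \<Longrightarrow> card e = 2"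
  shows "{e \<in> E. v \<in> e} = (\<lambda>u. {v, u}) ` nbrs E v"
proof (intro equalityI subsetI)
  fix e assume "e \<in> {e \<in> E. v \<in> e}"
  moreover from this obtain a b where "e = {a, b}" using assms card_2_iff by (metis mem_Collect_eq)
  ultimately show "e \<in> (\<lambda>u. {v, u}) ` nbrs E v" by (auto simp: nbrs_def insert_commute)
qed (auto simp: nbrs_def)

lemma inj_on_pair: "inj_on (\<lambda>u. {v, u}) A"
  by (auto simp: inj_on_def doubleton_eq_iff)

lemma self_notin_nbrs: "(\<And>e. e \<in> E \<Longrightarrow> card e = 2) \<Longrightarrow> v \<notin> nbrs E v"
  by (force simp: nbrs_def)

locale regular_graph =
  fixes n d :: nat and G :: "nat ugraph" and E :: "nat set set"
  assumes G: "G \<in> regular_graphs n d" and E_def: "E = edges G"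
begin

lemma edge_card: "e \<in> E \<Longrightarrow> card e = 2"
  and edge_sub: "e \<in> E \<Longrightarrow> e \<subseteq> {1..n}"
  using G by (auto simp: regular_graphs_def simple_graph_def E_def)

lemma G_eq: "G = ({1..n}, E)"
  using G by (cases G) (auto simp: regular_graphs_def E_def)

lemma finite_E: "finite E"
  by (rule finite_subset[of _ "Pow {1..n}"]) (use edge_sub in auto)

lemma nbrs_sub: "nbrs E v \<subseteq> {1..n}"
  using edge_sub by (force simp: nbrs_def)

lemma finite_nbrs: "finite (nbrs E v)"
  using nbrs_sub finite_subset by blast

lemma card_edges_at:
  assumes "v \<in> {1..n}" shows "card {e \<in> E. v \<in> e} = d"
  using assms G by (auto simp: regular_graphs_def regular_def graph_degree_def E_def)

lemma card_nbrs:
  assumes "v \<in> {1..n}" shows "card (nbrs E v) = d"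
  using card_edges_at[OF assms] edges_at_eq_image_nbrs[of E v, OF edge_card]
  by (simp add: card_image[OF inj_on_pair])

lemma card_E: "2 * card E = d * n"
proof -
  have "(\<Sum>v\<in>{1..n}. card {e \<in> E. v \<in> e}) = 2 * card E"
  proof (rule sum_multicount)
    show "\<forall>e\<in>E. card {v \<in> {1..n}. v \<in> e} = 2"
    proof
      fix e assume e: "e \<in> E"
      then have "{v \<in> {1..n}. v \<in> e} = e" using edge_sub by blast
      then show "card {v \<in> {1..n}. v \<in> e} = 2" using edge_card[OF e] by simp
    qed
  qed (use finite_E in auto)
  then show ?thesis using card_edges_at by (simp add: mult.commute)
qed

lemma near_bound:
  assumes "v \<in> {1..n}"
  shows "finite (near E v) \<and> card (near E v) \<le> d + d * d + d * d * d"
proof -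
  have c2: "card (\<Union>y\<in>nbrs E u. nbrs E y) \<le> d * d" if "u \<in> {1..n}" for u
  proof -
    have "card (\<Union>y\<in>nbrs E u. nbrs E y) \<le> (\<Sum>y\<in>nbrs E u. card (nbrs E y))"
      by (rule card_UN_le[OF finite_nbrs])
    also have "\<dots> \<le> (\<Sum>y\<in>nbrs E u. d)"
      using nbrs_sub by (intro sum_mono) (auto simp: card_nbrs subset_iff)
    also have "\<dots> = d * d" using card_nbrs[OF that] by simp
    finally show ?thesis .
  qed
  have "card (\<Union>y\<in>nbrs E v. \<Union>z\<in>nbrs E y. nbrs E z)
      \<le> (\<Sum>y\<in>nbrs E v. card (\<Union>z\<in>nbrs E y. nbrs E z))"
    by (rule card_UN_le[OF finite_nbrs])
  also have "\<dots> \<le> (\<Sum>y\<in>nbrs E v. d * d)"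
    using nbrs_sub c2 by (intro sum_mono) (auto simp: subset_iff)
  also have "\<dots> = d * d * d" using card_nbrs[OF assms] by simp
  finally have "card (near E v) \<le> d + d * d + d * d * d"
    unfolding near_def using c2[OF assms] card_nbrs[OF assms] card_Un_le
    by (smt (verit) add_mono le_trans order_refl)
  then show ?thesis using finite_nbrs by (auto simp: near_def)
qed

lemma ex_far_apart:
  assumes "A \<subseteq> {1..n}"
  obtains T where "T \<subseteq> A" "\<And>x y. x \<in> T \<Longrightarrow> y \<in> T \<Longrightarrow> x \<noteq> y \<Longrightarrow> y \<notin> near E x"
    "card A \<le> (d + d * d + d * d * d + 1) * card T"
proof -
  have "\<exists>T\<subseteq>A. (\<forall>x\<in>T. \<forall>y\<in>T. x \<noteq> y \<longrightarrow> y \<notin> near E x) \<and> card A \<le> (d + d * d + d * d * d + 1) * card T"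
    using assms near_bound near_sym finite_subset[OF assms]
    by (intro ex_independent_subset) auto
  then show ?thesis using that by blast
qed

end

subsection \<open>Cycles of partial injections\<close>

text \<open>\<open>orbit F y\<close> begins with \<open>F y\<close>, so
  \<open>y \<in> orbit F y\<close> says that \<open>y\<close> is periodic.\<close>

definition cyclic_points :: "('a \<Rightarrow> 'a) \<Rightarrow> 'a set \<Rightarrow> 'a set" where
  "cyclic_points F Y = {y \<in> Y. y \<in> orbit F y \<and> orbit F y \<subseteq> Y}"

definition cycle_reps :: "('a \<Rightarrow> 'a) \<Rightarrow> 'a set \<Rightarrow> 'a set \<Rightarrow> bool" where
  "cycle_reps F Y R \<longleftrightarrow> R \<subseteq> cyclic_points F Y \<and> (\<forall>y\<in>cyclic_points F Y. \<exists>!r. r \<in> R \<and> r \<in> orbit F y)"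

lemma orbit_eq_if_mem:
  assumes "y \<in> orbit F y" "z \<in> orbit F y"
  shows "orbit F z = orbit F y"
  using assms orbit_swap[OF assms] orbit_trans by (metis subsetI subset_antisym)

lemma cyclic_points_orbit:
  assumes "y \<in> cyclic_points F Y" "z \<in> orbit F y"
  shows "z \<in> cyclic_points F Y" "orbit F z = orbit F y"
  using assms orbit_eq_if_mem[of y F z] by (auto simp: cyclic_points_def)

text \<open>A cycle of length \<open>l\<close> contributes \<open>l\<close> terms
  \<open>1 / l\<close>, that is, one representative. Counting by a sum over points lets cycles of
  vertices and cycles of edges be compared locally later.\<close>

lemma ex_cycle_reps:
  assumes "finite Y"
  obtains R where "cycle_reps F Y R"
    and "real (card R) = (\<Sum>y\<in>cyclic_points F Y. 1 / real (card (orbit F y)))"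
proof -
  let ?C = "cyclic_points F Y"
  have finC: "finite ?C" using assms by (auto simp: cyclic_points_def)
  define Bs where "Bs = orbit F ` ?C"
  define pick where "pick B = (SOME y. y \<in> B \<and> y \<in> ?C \<and> orbit F y = B)" for B
  have pick: "pick B \<in> B \<and> pick B \<in> ?C \<and> orbit F (pick B) = B" if "B \<in> Bs" for B
  proof -
    from that obtain y where "y \<in> ?C" "B = orbit F y" by (auto simp: Bs_def)
    then have "y \<in> B \<and> y \<in> ?C \<and> orbit F y = B" by (auto simp: cyclic_points_def)
    then show ?thesis unfolding pick_def by (rule someI)
  qed
  define R where "R = pick ` Bs"
  have inj: "inj_on pick Bs" by (rule inj_onI) (metis pick)
  have "cycle_reps F Y R"
    unfolding cycle_reps_def
  proof (intro conjI ballI)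
    show "R \<subseteq> ?C" using pick by (auto simp: R_def)
    fix y assume y: "y \<in> ?C"
    then have o: "orbit F y \<in> Bs" by (auto simp: Bs_def)
    show "\<exists>!r. r \<in> R \<and> r \<in> orbit F y"
    proof (rule ex1I[of _ "pick (orbit F y)"])
      show "pick (orbit F y) \<in> R \<and> pick (orbit F y) \<in> orbit F y"
        using pick[OF o] o by (auto simp: R_def)
      fix r assume r: "r \<in> R \<and> r \<in> orbit F y"
      then obtain B where "B \<in> Bs" "r = pick B" by (auto simp: R_def)
      with pick[of B] cyclic_points_orbit(2)[OF y, of r] r show "r = pick (orbit F y)" by auto
    qed
  qed
  moreover have "real (card R) = (\<Sum>y\<in>?C. 1 / real (card (orbit F y)))"
  proof -
    have "(\<Sum>y\<in>?C. 1 / real (card (orbit F y)))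
        = (\<Sum>B\<in>Bs. \<Sum>y\<in>{y\<in>?C. orbit F y = B}. 1 / real (card (orbit F y)))"
      unfolding Bs_def by (rule sum.image_gen[OF finC])
    also have "\<dots> = (\<Sum>B\<in>Bs. 1)"
    proof (rule sum.cong[OF refl])
      fix B assume B: "B \<in> Bs"
      then obtain y where y: "y \<in> ?C" "B = orbit F y" by (auto simp: Bs_def)
      have eq: "{z\<in>?C. orbit F z = B} = B"
      proof (intro subset_antisym subsetI)
        fix z assume "z \<in> {z\<in>?C. orbit F z = B}"
        then show "z \<in> B" unfolding cyclic_points_def by blast
      next
        fix z assume "z \<in> B"
        with y cyclic_points_orbit[of y F Y z] show "z \<in> {z\<in>?C. orbit F z = B}" by blast
      qed
      have fin: "finite B" using y finite_orbit[of y F] by (auto simp: cyclic_points_def)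
      have ne: "B \<noteq> {}" using y orbit_nonempty[of F y] by auto
      have "(\<Sum>z\<in>{z\<in>?C. orbit F z = B}. 1 / real (card (orbit F z)))
          = (\<Sum>z\<in>{z\<in>?C. orbit F z = B}. 1 / real (card B))"
        by (rule sum.cong) auto
      also have "\<dots> = 1" using eq fin ne by simp
      finally show "(\<Sum>z\<in>{z\<in>?C. orbit F z = B}. 1 / real (card (orbit F z))) = 1" .
    qed
    also have "\<dots> = real (card R)" using card_image[OF inj] by (simp add: R_def)
    finally show ?thesis by simp
  qed
  ultimately show ?thesis using that by blast
qed

text \<open>Pigeonhole gives two equal iterates; injectivity on \<open>Y\<close> strips common
  applications of \<open>F\<close> until one of them is \<open>y\<close> itself.\<close>

lemma funpow_in_imp_cyclic:
  assumes "finite Y" "inj_on F Y" "\<And>k. (F ^^ k) y \<in> Y"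
  shows "y \<in> cyclic_points F Y"
proof -
  have "\<not> inj (\<lambda>k. (F ^^ k) y)"
  proof
    assume "inj (\<lambda>k. (F ^^ k) y)"
    then have "infinite (range (\<lambda>k. (F ^^ k) y))" using finite_imageD by blast
    moreover have "range (\<lambda>k. (F ^^ k) y) \<subseteq> Y" using assms(3) by auto
    ultimately show False using assms(1) finite_subset by blast
  qed
  then obtain i j where ij: "i < j" "(F ^^ i) y = (F ^^ j) y"
    unfolding inj_def by (metis (no_types) nat_neq_iff)
  have canc: "y = (F ^^ l) y" if "(F ^^ i) y = (F ^^ (i + l)) y" for i l
    using that
  proof (induction i)
    case (Suc i)
    then have "F ((F ^^ i) y) = F ((F ^^ (i + l)) y)" by simp
    then show ?case using Suc.IH assms(2,3) by (auto dest: inj_onD)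
  qed simp
  have "(F ^^ (j - i)) y = y" using canc[of i "j - i"] ij by simp
  then have "y \<in> orbit F y" using ij(1) unfolding orbit_altdef
    by (metis (mono_tags, lifting) mem_Collect_eq zero_less_diff)
  moreover have "orbit F y \<subseteq> Y" using assms(3) by (auto simp: orbit_altdef)
  moreover have "y \<in> Y" using assms(3)[of 0] by simp
  ultimately show ?thesis by (simp add: cyclic_points_def)
qed

text \<open>An iteration that never left \<open>Y\<close> would run round a cycle inside
  \<open>Y\<close> and so pass through its representative.\<close>

lemma cycle_reps_escape:
  assumes "finite Y" "inj_on F Y" "cycle_reps F Y R"
  obtains k where "(F ^^ k) y \<notin> Y - R" "\<And>j. j < k \<Longrightarrow> (F ^^ j) y \<in> Y - R"
proof -
  have "\<exists>k. (F ^^ k) y \<notin> Y - R"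
  proof (rule ccontr)
    assume "\<not> ?thesis"
    then have a: "\<And>k. (F ^^ k) y \<in> Y - R" by auto
    then have "y \<in> cyclic_points F Y" using funpow_in_imp_cyclic[of Y F y] assms by blast
    then obtain r where "r \<in> R" "r \<in> orbit F y" using assms(3) by (auto simp: cycle_reps_def)
    then show False using a by (auto simp: orbit_altdef)
  qed
  then obtain k where "(F ^^ k) y \<notin> Y - R" "\<forall>j<k. (F ^^ j) y \<in> Y - R"
    using exists_least_iff[of "\<lambda>k. (F ^^ k) y \<notin> Y - R"] by auto
  then show ?thesis using that by blast
qed

text \<open>On a cycle, the image of the representative is the only point of the cycle that is
  not hit by the remaining points, so it need not be recorded.\<close>

lemma eq_on_if_eq_off_cycle_reps:
  assumes "inj_on f Y" "inj_on g Y"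
    and R: "cycle_reps f Y R" "cycle_reps g Y R"
    and eq: "\<And>y. y \<in> Y - R \<Longrightarrow> f y = g y"
    and y: "y \<in> Y"
  shows "f y = g y"
proof (cases "y \<in> R")
  case False
  then show ?thesis using eq y by auto
next
  case True
  from True R have yf: "y \<in> cyclic_points f Y" and yg: "y \<in> cyclic_points g Y"
    by (auto simp: cycle_reps_def)
  have Ruf: "r = y" if "r \<in> R" "r \<in> orbit f y" for r
    using R(1) yf that True unfolding cycle_reps_def cyclic_points_def by blast
  have Rug: "r = y" if "r \<in> R" "r \<in> orbit g y" for r
    using R(2) yg that True unfolding cycle_reps_def cyclic_points_def by blast
  have fo: "orbit f y \<subseteq> Y" and go: "orbit g y \<subseteq> Y" and ys: "y \<in> orbit f y" "y \<in> orbit g y"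
    using yf yg by (auto simp: cyclic_points_def)
  from ys(1) obtain k where k: "0 < k" "(f ^^ k) y = y" by (auto simp: orbit_altdef)
  define k0 where "k0 = (LEAST k. 0 < k \<and> (f ^^ k) y = y)"
  have k0: "0 < k0" "(f ^^ k0) y = y" unfolding k0_def using k by (metis (mono_tags, lifting) LeastI)+
  have least: "(f ^^ i) y \<noteq> y" if "0 < i" "i < k0" for i
    using that not_less_Least[of i "\<lambda>k. 0 < k \<and> (f ^^ k) y = y"] unfolding k0_def by auto
  \<comment> \<open>Before its first return the \<open>f\<close>-cycle of \<open>y\<close> meets no
    other representative, so \<open>g\<close> agrees with \<open>f\<close> at every point passed
    after \<open>y\<close>.\<close>
  have same: "(g ^^ i) (f y) = (f ^^ Suc i) y" if "i < k0" for i
    using that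
  proof (induction i)
    case (Suc i)
    have "(f ^^ Suc i) y \<in> orbit f y" unfolding orbit_altdef by blast
    moreover have "(f ^^ Suc i) y \<notin> R" using Ruf least[of "Suc i"] Suc.prems calculation by blast
    ultimately have "g ((f ^^ Suc i) y) = f ((f ^^ Suc i) y)" using eq fo by (metis DiffI subsetD)
    then show ?case using Suc by simp
  qed simp
  have ret: "(g ^^ (k0 - 1)) (f y) = y" using same[of "k0 - 1"] k0 by (metis Suc_pred' diff_less zero_less_one)
  have step: "z \<in> orbit g y" if "g z \<in> orbit g y" "z \<in> Y" for z
  proof -
    have "\<exists>u\<in>orbit g y. g u = g z"
      using that(1) by cases (use ys(2) in auto)
    then show ?thesis using assms(2) go that(2) by (metis inj_onD subsetD)
  qed
  \<comment> \<open>The path under \<open>g\<close> from \<open>f y\<close> ends in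
    \<open>y\<close>; walking back along it with \<open>step\<close> stays in the
    \<open>g\<close>-cycle of \<open>y\<close>.\<close>
  have "f y \<in> orbit g y"
  proof -
    have "(g ^^ (k0 - 1 - i)) (f y) \<in> orbit g y" if "i \<le> k0 - 1" for i
      using that
    proof (induction i)
      case 0 then show ?case using ret ys(2) by simp
    next
      case (Suc i)
      then have "g ((g ^^ (k0 - 1 - Suc i)) (f y)) = (g ^^ (k0 - 1 - i)) (f y)"
        by (metis Suc_diff_Suc Suc_le_lessD comp_apply funpow.simps(2))
      moreover have "(g ^^ (k0 - 1 - Suc i)) (f y) \<in> Y"
      proof -
        have "(f ^^ Suc (k0 - 1 - Suc i)) y \<in> orbit f y" unfolding orbit_altdef by blast
        then show ?thesis using same[of "k0 - 1 - Suc i"] fo k0(1) by auto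
      qed
      ultimately show ?case using step Suc by auto
    qed
    from this[of "k0 - 1"] show ?thesis by simp
  qed
  then obtain p where p: "p \<in> orbit g y" "g p = f y"
    by cases (use ys(2) in auto)
  \<comment> \<open>The \<open>g\<close>-predecessor \<open>p\<close> of \<open>f y\<close> must be
    a representative: elsewhere \<open>f\<close> and \<open>g\<close> agree, and
    \<open>f p = f y\<close> forces \<open>p = y\<close>.\<close>
  have "p \<in> R"
  proof (rule ccontr)
    assume "p \<notin> R"
    then have "f p = f y" using eq p go by auto
    then have "p = y" using assms(1) p go y by (metis inj_onD subsetD)
    with \<open>p \<notin> R\<close> True show False by simp
  qed
  then have "p = y" using Rug p by blast
  then show ?thesis using p by simp
qed

subsection \<open>Compression along a partial isomorphism\<close>

lemma card_orbit_least_period: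
  assumes "x \<in> orbit f x"
  shows "0 < card (orbit f x)" "(f ^^ card (orbit f x)) x = x"
    and "0 < i \<Longrightarrow> i < card (orbit f x) \<Longrightarrow> (f ^^ i) x \<noteq> x"
proof -
  define p where "p = (LEAST p. 0 < p \<and> (f ^^ p) x = x)"
  have ex: "\<exists>p. 0 < p \<and> (f ^^ p) x = x" using assms unfolding orbit_altdef by auto
  have p: "0 < p" "(f ^^ p) x = x" using LeastI_ex[OF ex] by (auto simp: p_def)
  have least: "(f ^^ i) x \<noteq> x" if "0 < i" "i < p" for i
    using that not_less_Least[of i "\<lambda>p. 0 < p \<and> (f ^^ p) x = x"] unfolding p_def by auto
  have "inj_on (\<lambda>m. (f ^^ m) x) {..<p}"
  proof (rule linorder_inj_onI)
    fix i j assume ij: "i < j" "i \<in> {..<p}" "j \<in> {..<p}"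
    show "(f ^^ i) x \<noteq> (f ^^ j) x"
    proof
      assume "(f ^^ i) x = (f ^^ j) x"
      then have "(f ^^ (p - j + i)) x = (f ^^ (p - j + j)) x" by (simp only: funpow_add o_apply)
      then have "(f ^^ (p - j + i)) x = x" using ij p by simp
      moreover have "0 < p - j + i" "p - j + i < p" using ij by auto
      ultimately show False using least[of "p - j + i"] \<open>(f ^^ (p - j + i)) x = x\<close> by simp
    qed
  qed auto
  moreover have "orbit f x = (\<lambda>m. (f ^^ m) x) ` {..<p}"
    using orbit_altdef_bounded[OF p(2) p(1)] by auto
  ultimately have "card (orbit f x) = p" by (simp add: card_image)
  then show "0 < card (orbit f x)" "(f ^^ card (orbit f x)) x = x"
    and "0 < i \<Longrightarrow> i < card (orbit f x) \<Longrightarrow> (f ^^ i) x \<noteq> x"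
    using p least by auto
qed

text \<open>If \<open>f\<close> swaps the ends of an edge after half a period, the orbit of the edge is only half as long
  as those of its ends, too short for the gain estimate below. All such edges have the form
  \<open>{x, antipode f x}\<close>, so they are recorded by one bit per vertex instead. (If \<open>orbit f x\<close> is infinite,
  \<open>antipode f x = x\<close> and no edge arises.)\<close>

definition antipode :: "('a \<Rightarrow> 'a) \<Rightarrow> 'a \<Rightarrow> 'a" where
  "antipode f x = (f ^^ (card (orbit f x) div 2)) x"

text \<open>Let \<open>m\<close> be the remainder of \<open>k\<close> modulo the period. It lies
  strictly between 0 and the period because \<open>x \<noteq> y\<close>, while the period divides
  \<open>m + m\<close>; so \<open>m\<close> is exactly half of it.\<close>

lemma antipode_eqI:
  assumes "(f ^^ k) x = y" "(f ^^ k) y = x" "x \<noteq> y"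
  shows "y = antipode f x"
proof -
  have k: "0 < k" using assms by (cases k) auto
  have "(f ^^ (k + k)) x = x" using assms by (simp add: funpow_add)
  then have o: "x \<in> orbit f x" using k unfolding orbit_altdef by (metis (mono_tags, lifting) add_gr_0 mem_Collect_eq)
  let ?p = "card (orbit f x)"
  note p = card_orbit_least_period[OF o]
  define m where "m = k mod ?p"
  have m: "(f ^^ m) x = y" unfolding m_def using funpow_mod_eq[OF p(2)] assms(1) by simp
  have m0: "0 < m" using m assms(3) by (cases m) auto
  have mp: "m < ?p" using p(1) by (simp add: m_def)
  have "(f ^^ ((k + k) mod ?p)) x = x"
    using funpow_mod_eq[OF p(2), of "k + k"] \<open>(f ^^ (k + k)) x = x\<close> by simp
  moreover have "(k + k) mod ?p < ?p" using p(1) by simp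
  ultimately have "(k + k) mod ?p = 0" using p(3)[of "(k + k) mod ?p"] by blast
  then have "(m + m) mod ?p = 0" unfolding m_def by (simp add: mod_add_eq)
  then have "?p dvd m + m" by auto
  then obtain c where c: "m + m = ?p * c" by (auto simp: dvd_def)
  have "c = 1"
  proof -
    have "c \<noteq> 0" using c m0 by (cases c) auto
    moreover have "\<not> 2 \<le> c"
    proof
      assume "2 \<le> c"
      then have "?p * 2 \<le> ?p * c" by (rule mult_le_mono2)
      then show False using c mp by linarith
    qed
    ultimately show ?thesis by simp
  qed
  then have "m = ?p div 2" using c by simp
  then show ?thesis using m by (simp add: antipode_def)
qed

section \<open>Decoding of edges, and weights of moved vertices\<close>

lemma funpow_image:
  fixes f :: "'a \<Rightarrow> 'a"
  shows "((`) f ^^ k) A = (f ^^ k) ` A"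
  by (induction k) (auto simp: image_comp)

text \<open>The decoder: a pair is accepted if pushing it forward by \<open>f\<close> reaches the
  recorded set \<open>S\<close> with all earlier stages inside \<open>U\<close>, where
  \<open>f\<close> is to preserve adjacency. The case \<open>k = 0\<close> accepts the pairs in
  \<open>S\<close> themselves.\<close>

definition unfold_edges :: "('a \<Rightarrow> 'a) \<Rightarrow> 'a set \<Rightarrow> 'a set set \<Rightarrow> 'a set set" where
  "unfold_edges f U S =
    {e. card e = 2 \<and> (\<exists>k. ((`) f ^^ k) e \<in> S \<and> (\<forall>j<k. ((`) f ^^ j) e \<subseteq> U))}"

definition touching :: "'a set set \<Rightarrow> 'a set \<Rightarrow> 'a set \<Rightarrow> 'a set set" where
  "touching E U M = {e \<in> E. e \<subseteq> U \<and> e \<inter> M \<noteq> {}}"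

text \<open>Each edge of \<open>touching E U M\<close> shares one unit equally among its ends in
  \<open>M\<close>; this is the total that \<open>v\<close> receives.\<close>

definition weight :: "'a set set \<Rightarrow> 'a set \<Rightarrow> 'a set \<Rightarrow> 'a \<Rightarrow> real" where
  "weight E U M v = (\<Sum>e | e \<in> touching E U M \<and> v \<in> e. 1 / real (card (e \<inter> M)))"

text \<open>Localizes a count: every point counts one, less its share of the representative of its
  cycle.\<close>

lemma card_diff_reps:
  assumes "finite X" "R \<subseteq> C" "C \<subseteq> X" "real (card R) = (\<Sum>y\<in>C. a y)"
  shows "real (card (X - R)) = (\<Sum>y\<in>X. 1 - (if y \<in> C then a y else (0::real)))"
proof -
  have "(\<Sum>y\<in>X. 1 - (if y \<in> C then a y else 0)) = real (card X) - (\<Sum>y\<in>X. if y \<in> C then a y else 0)"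
    by (simp add: sum_subtractf)
  also have "(\<Sum>y\<in>X. if y \<in> C then a y else 0) = (\<Sum>y\<in>C. a y)"
    using assms by (simp flip: sum.inter_restrict add: Int_absorb1)
  also have "real (card X) - (\<Sum>y\<in>C. a y) = real (card (X - R))"
  proof -
    have "R \<subseteq> X" using assms by auto
    then have "card (X - R) = card X - card R" "card R \<le> card X"
      using assms(1) by (auto simp: card_Diff_subset finite_subset card_mono)
    then show ?thesis using assms(4) by simp
  qed
  finally show ?thesis by simp
qed

text \<open>\<open>moved\<close> speaks of all points, so \<open>f\<close> is the identity off
  \<open>M\<close> and in particular off \<open>U\<close>. The image of \<open>U\<close> may leave
  \<open>U\<close>.\<close>

locale partial_iso =
  fixes E :: "'a set set" and U M :: "'a set" and f :: "'a \<Rightarrow> 'a"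
  assumes finE: "finite E" and E2: "\<And>e. e \<in> E \<Longrightarrow> card e = 2"
    and finU: "finite U" and MU: "M \<subseteq> U" and injf: "inj_on f U"
    and moved: "\<And>x. x \<in> M \<longleftrightarrow> f x \<noteq> x"
    and iso: "\<And>x y. x \<in> U \<Longrightarrow> y \<in> U \<Longrightarrow> {x, y} \<in> E \<longleftrightarrow> {f x, f y} \<in> E"
begin

abbreviation F where "F \<equiv> (`) f"

abbreviation antipodal where "antipodal \<equiv> range (\<lambda>x. {x, antipode f x})"

abbreviation Y where "Y \<equiv> touching E U M - antipodal"

lemma iso_edge:
  assumes "e \<subseteq> U" "card e = 2"
  shows "f ` e \<in> E \<longleftrightarrow> e \<in> E" "card (f ` e) = 2"
proof -
  obtain x y where e: "e = {x, y}" using assms(2) card_2_iff by metis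
  show "f ` e \<in> E \<longleftrightarrow> e \<in> E" using iso[of x y] assms(1) by (simp add: e)
  show "card (f ` e) = 2" using assms card_image inj_on_subset[OF injf] by metis
qed

lemma finM: "finite M" using MU finU finite_subset by blast

lemma fin_touching: "finite (touching E U M)"
  using finE by (auto simp: touching_def)

lemma inj_F: "inj_on F (touching E U M)"
  using inj_on_image_Pow[OF injf] by (rule inj_on_subset) (auto simp: touching_def)

lemma inj_f_M: "inj_on f M"
  using injf MU inj_on_subset by blast

text \<open>Soundness of the decoder: adjacency is pulled back one application of \<open>f\<close>
  at a time, each time within \<open>U\<close>.\<close>

lemma unfold_subset:
  assumes "S \<subseteq> E" shows "unfold_edges f U S \<subseteq> E"
proof -
  have "e \<in> E" if "card e = 2" "(F ^^ k) e \<in> S" "\<forall>j<k. (F ^^ j) e \<subseteq> U" for k e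
    using that
  proof (induction k arbitrary: e)
    case 0 then show ?case using assms by auto
  next
    case (Suc k)
    have eU: "e \<subseteq> U" using Suc.prems(3) by (metis funpow_0 zero_less_Suc)
    have "\<forall>j<k. (F ^^ j) (F e) \<subseteq> U"
      using Suc.prems(3) by (metis Suc_less_eq funpow_simps_right(2) o_apply)
    moreover have "(F ^^ k) (F e) \<in> S" using Suc.prems(2) by (simp add: funpow_swap1)
    ultimately have "F e \<in> E" using Suc.IH[of "F e"] iso_edge[OF eU Suc.prems(1)] by simp
    then show ?case using iso_edge[OF eU Suc.prems(1)] by simp
  qed
  then show ?thesis by (auto simp: unfold_edges_def)
qed

text \<open>Completeness of the decoder: push an edge forward until it first leaves
  \<open>Y - R\<close>. All stages before lie in \<open>U\<close>, where \<open>f\<close> preserves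
  edges, so the result is still an edge and hence recorded.\<close>

lemma unfold_reps:
  assumes "cycle_reps F Y R"
  shows "unfold_edges f U (E - (Y - R)) = E"
proof (intro equalityI subsetI)
  fix e assume e: "e \<in> E"
  obtain k where k: "(F ^^ k) e \<notin> Y - R" "\<And>j. j < k \<Longrightarrow> (F ^^ j) e \<in> Y - R"
  proof (rule cycle_reps_escape[OF _ _ assms])
    show "finite Y" using fin_touching by simp
    show "inj_on F Y" using inj_F by (rule inj_on_subset) auto
  qed blast
  have U: "\<forall>j<k. (F ^^ j) e \<subseteq> U" using k(2) by (auto simp: touching_def)
  have "(F ^^ k) e \<in> E"
  proof (cases k)
    case (Suc j)
    then have "(F ^^ j) e \<in> E" using k(2)[of j] by (auto simp: touching_def)
    then show ?thesis using iso_edge(1)[of "(F ^^ j) e"] U Suc E2 by simp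
  qed (use e in simp)
  then show "e \<in> unfold_edges f U (E - (Y - R))"
    using k U E2[OF e] by (auto simp: unfold_edges_def)
qed (use unfold_subset[of "E - (Y - R)"] in auto)

text \<open>After one period of \<open>e\<close> its two ends are fixed or exchanged. An exchange
  would make \<open>e\<close> antipodal and exclude it from \<open>Y\<close>; so \<open>v\<close>
  has returned by then.\<close>

lemma cyclic_edge:
  assumes e: "e \<in> cyclic_points F Y" and v: "v \<in> e" "v \<in> M"
  shows "v \<in> cyclic_points f M" "card (orbit f v) \<le> card (orbit F e)"
proof -
  have eo: "e \<in> orbit F e" "orbit F e \<subseteq> Y" "e \<in> Y" using e by (auto simp: cyclic_points_def)
  have Fj: "(F ^^ j) e \<in> Y" for j
    using eo orbit_altdef_self_in[OF eo(1)] by auto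
  have fU: "(f ^^ j) v \<in> U" for j
  proof -
    have "(f ^^ j) v \<in> (F ^^ j) e" using v by (simp add: funpow_image)
    then show ?thesis using Fj[of j] by (auto simp: touching_def)
  qed
  obtain u where u: "e = {v, u}" "u \<noteq> v"
  proof -
    have "card e = 2" using eo E2 by (auto simp: touching_def)
    then show ?thesis using v that by (auto simp: card_2_iff)
  qed
  define q where "q = card (orbit F e)"
  have q: "0 < q" "(F ^^ q) e = e" using card_orbit_least_period[OF eo(1)] by (auto simp: q_def)
  have "(f ^^ q) ` {v, u} = {v, u}" using q(2) u by (simp add: funpow_image)
  then have "(f ^^ q) v = v \<or> (f ^^ q) v = u \<and> (f ^^ q) u = v" by (auto simp: doubleton_eq_iff)
  moreover have "\<not> ((f ^^ q) v = u \<and> (f ^^ q) u = v)"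
  proof
    assume "(f ^^ q) v = u \<and> (f ^^ q) u = v"
    then have "e = {v, antipode f v}" using antipode_eqI[of q f v u] u by auto
    then show False using eo(3) by auto
  qed
  ultimately have fq: "(f ^^ q) v = v" by simp
  \<comment> \<open>A point outside \<open>M\<close> is fixed, so an orbit leaving \<open>M\<close>
    could not be back at \<open>v\<close> at time \<open>q * j\<close>, which is at least
    \<open>j\<close>.\<close>
  have stay: "(f ^^ (i + j)) v = (f ^^ j) v" if "(f ^^ j) v \<notin> M" for i j
    using that moved by (induction i) auto
  have "(f ^^ j) v \<in> M" for j
  proof (rule ccontr)
    assume j: "(f ^^ j) v \<notin> M"
    have "(f ^^ (q * j)) v = v"
      using fq by (induction j) (auto simp: funpow_add)
    moreover have "q * j = (q * j - j) + j" using q(1) by (cases q) auto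
    ultimately show False using stay[OF j, of "q * j - j"] j v by simp
  qed
  then show "v \<in> cyclic_points f M" using funpow_in_imp_cyclic[OF finM inj_f_M] by blast
  have "orbit f v = (\<lambda>m. (f ^^ m) v) ` {..<q}" using orbit_altdef_bounded[OF fq q(1)] by auto
  then show "card (orbit f v) \<le> card (orbit F e)"
    unfolding q_def[symmetric] using card_image_le[of "{..<q}" "\<lambda>m. (f ^^ m) v"] by simp
qed

text \<open>Summed over \<open>M\<close> this is \<open>card (M - R)\<close>, the labels spent on
  \<open>f\<close>; the analogous \<open>edge_gain\<close> sums to the number of edges saved. A
  point on a cycle is refunded its share of the unrecorded representative.\<close>

definition vertex_gain :: "'a \<Rightarrow> real" where
  "vertex_gain v = 1 - (if v \<in> cyclic_points f M then 1 / real (card (orbit f v)) else 0)"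

definition edge_gain :: "'a set \<Rightarrow> real" where
  "edge_gain e = 1 - (if e \<in> cyclic_points F Y then 1 / real (card (orbit F e)) else 0)"

lemma vertex_gain_bounds:
  assumes "v \<in> M" shows "1 / 2 \<le> vertex_gain v" "vertex_gain v \<le> 1"
proof -
  have "2 \<le> card (orbit f v)" if c: "v \<in> cyclic_points f M"
  proof -
    have o: "v \<in> orbit f v" using c by (simp add: cyclic_points_def)
    have "card {v, f v} \<le> card (orbit f v)"
      using o orbit.base[of f v] finite_orbit[OF o] by (intro card_mono) auto
    then show ?thesis using moved[of v] assms by simp
  qed
  then show "1 / 2 \<le> vertex_gain v" "vertex_gain v \<le> 1"
    by (auto simp: vertex_gain_def field_simps)
qed

lemma vertex_gain_le_edge_gain:
  assumes "v \<in> e" "v \<in> M"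
  shows "vertex_gain v \<le> edge_gain e"
proof (cases "e \<in> cyclic_points F Y")
  case True
  note c = cyclic_edge[OF True assms]
  have "0 < card (orbit f v)"
    using c(1) card_orbit_least_period(1)[of v f] by (auto simp: cyclic_points_def)
  then have "1 / real (card (orbit F e)) \<le> 1 / real (card (orbit f v))"
    using c(2) by (intro divide_left_mono) auto
  then show ?thesis using True c(1) by (simp add: vertex_gain_def edge_gain_def)
next
  case False
  then show ?thesis using vertex_gain_bounds[OF assms(2)] by (simp add: edge_gain_def)
qed

text \<open>The orbit of an edge outside \<open>antipodal\<close> is at least as long as the orbits of its moved
  ends. Hence every edge saves at least the average of what its moved ends cost.\<close>

lemma gain_inequality:
  assumes w: "\<And>v. v \<in> M \<Longrightarrow> 1 \<le> weight E U M v"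
  shows "(\<Sum>v\<in>M. vertex_gain v) + (\<Sum>v\<in>M. weight E U M v - 1) / 2
    \<le> (\<Sum>e\<in>touching E U M. edge_gain e)"
proof -
  let ?T = "touching E U M"
  have "(\<Sum>v\<in>M. vertex_gain v * weight E U M v)
      = (\<Sum>v\<in>M. \<Sum>e | e \<in> ?T \<and> v \<in> e. vertex_gain v * (1 / real (card (e \<inter> M))))"
    unfolding weight_def by (simp add: sum_distrib_left)
  also have "\<dots> = (\<Sum>e\<in>?T. \<Sum>v | v \<in> M \<and> v \<in> e. vertex_gain v * (1 / real (card (e \<inter> M))))"
    by (rule sum.swap_restrict[OF finM fin_touching])
  also have "\<dots> \<le> (\<Sum>e\<in>?T. edge_gain e)"
  proof (rule sum_mono)
    fix e assume e: "e \<in> ?T"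
    have eq: "{v. v \<in> M \<and> v \<in> e} = e \<inter> M" by auto
    have pos: "0 < card (e \<inter> M)" using e finM by (auto simp: touching_def card_gt_0_iff)
    have "(\<Sum>v | v \<in> M \<and> v \<in> e. vertex_gain v * (1 / real (card (e \<inter> M))))
        \<le> (\<Sum>v\<in>e \<inter> M. edge_gain e * (1 / real (card (e \<inter> M))))"
      unfolding eq by (intro sum_mono mult_right_mono vertex_gain_le_edge_gain) auto
    also have "\<dots> = edge_gain e" using pos by simp
    finally show "(\<Sum>v | v \<in> M \<and> v \<in> e. vertex_gain v * (1 / real (card (e \<inter> M)))) \<le> edge_gain e" .
  qed
  finally have 1: "(\<Sum>v\<in>M. vertex_gain v * weight E U M v) \<le> (\<Sum>e\<in>?T. edge_gain e)" .
  \<comment> \<open>The excess weight is multiplied by at least 1/2, since a cycle of moved points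
    has length at least two.\<close>
  have "(\<Sum>v\<in>M. vertex_gain v + (weight E U M v - 1) / 2) \<le> (\<Sum>v\<in>M. vertex_gain v * weight E U M v)"
  proof (rule sum_mono)
    fix v assume v: "v \<in> M"
    have "1 / 2 * (weight E U M v - 1) \<le> vertex_gain v * (weight E U M v - 1)"
      using w[OF v] vertex_gain_bounds[OF v] by (intro mult_right_mono) auto
    then show "vertex_gain v + (weight E U M v - 1) / 2 \<le> vertex_gain v * weight E U M v"
      by (simp add: field_simps)
  qed
  with 1 show ?thesis by (simp add: sum.distrib sum_divide_distrib)
qed

text \<open>\<open>M - R\<close> is where \<open>f\<close> gets recorded and \<open>D\<close>
  consists of the edges written out; the antipodal edges come back from a set of vertices, which
  costs bits but no labels.\<close>

lemma ex_code:
  assumes w: "\<And>v. v \<in> M \<Longrightarrow> 1 \<le> weight E U M v"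
    and s: "\<kappa> * real (card M) \<le> (\<Sum>v\<in>M. weight E U M v - 1)"
  obtains R D where "cycle_reps f M R" "R \<subseteq> M" "D \<subseteq> E"
    "unfold_edges f U (D \<union> (\<lambda>x. {x, antipode f x}) ` {x. {x, antipode f x} \<in> E}) = E"
    "real (card (M - R)) + real (card D) \<le> real (card E) - \<kappa> / 2 * real (card M)"
proof -
  obtain R where R: "cycle_reps f M R"
      "real (card R) = (\<Sum>y\<in>cyclic_points f M. 1 / real (card (orbit f y)))"
    using ex_cycle_reps[OF finM] by blast
  have finY: "finite Y" using fin_touching by simp
  obtain S where S: "cycle_reps F Y S"
      "real (card S) = (\<Sum>y\<in>cyclic_points F Y. 1 / real (card (orbit F y)))"
    using ex_cycle_reps[OF finY] by blast
  define D where "D = E - antipodal - (Y - S)"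
  have "D \<union> (\<lambda>x. {x, antipode f x}) ` {x. {x, antipode f x} \<in> E} = E - (Y - S)"
    unfolding D_def by auto
  then have dec: "unfold_edges f U (D \<union> (\<lambda>x. {x, antipode f x}) ` {x. {x, antipode f x} \<in> E}) = E"
    using unfold_reps[OF S(1)] by simp
  have cM: "real (card (M - R)) = (\<Sum>v\<in>M. vertex_gain v)"
    unfolding vertex_gain_def using R finM
    by (intro card_diff_reps) (auto simp: cycle_reps_def cyclic_points_def)
  have cE: "real (card (touching E U M - S)) = (\<Sum>e\<in>touching E U M. edge_gain e)"
    unfolding edge_gain_def using S fin_touching
    by (intro card_diff_reps) (auto simp: cycle_reps_def cyclic_points_def)
  \<comment> \<open>Antipodal edges of \<open>touching E U M\<close> lie outside \<open>Y\<close>,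
    so their \<open>edge_gain\<close> is 1 and they count as saved in full.\<close>
  have "D \<subseteq> E - (touching E U M - S)" unfolding D_def by auto
  then have "card D \<le> card (E - (touching E U M - S))" using finE by (intro card_mono) auto
  also have "\<dots> = card E - card (touching E U M - S)"
    using fin_touching by (intro card_Diff_subset) (auto simp: touching_def)
  finally have "card D \<le> card E - card (touching E U M - S)" .
  moreover have "card (touching E U M - S) \<le> card E"
    using finE by (intro card_mono) (auto simp: touching_def)
  ultimately have "real (card D) \<le> real (card E) - (\<Sum>e\<in>touching E U M. edge_gain e)"
    using cE by linarith
  then have "real (card (M - R)) + real (card D) \<le> real (card E) - \<kappa> / 2 * real (card M)"
    using gain_inequality[OF w] s cM by simp
  moreover have "R \<subseteq> M" using R by (auto simp: cycle_reps_def cyclic_points_def)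
  moreover have "D \<subseteq> E" by (auto simp: D_def)
  ultimately show ?thesis using that R(1) dec by blast
qed

end

subsection \<open>Rarity of partial symmetries and of triangles\<close>

definition in_triangle :: "'a set set \<Rightarrow> 'a \<Rightarrow> bool" where
  "in_triangle E v \<longleftrightarrow> (\<exists>a b. {v, a} \<in> E \<and> {v, b} \<in> E \<and> {a, b} \<in> E)"

text \<open>The purpose: after deleting any part of \<open>T\<close>, every vertex has lost at most
  one neighbour, and of two adjacent remaining vertices at most one has lost any. Otherwise there
  would be a triangle at a vertex of \<open>T\<close> or a walk of at most three steps between two
  of them.\<close>

definition scattered :: "'a set set \<Rightarrow> 'a set \<Rightarrow> bool" where
  "scattered E T \<longleftrightarrow> (\<forall>x\<in>T. \<not> in_triangle E x \<and> (\<forall>y\<in>T. x \<noteq> y \<longrightarrow> y \<notin> near E x))"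

lemma nearI1: "y \<in> nbrs E x \<Longrightarrow> y \<in> near E x"
  and nearI2: "y \<in> nbrs E x \<Longrightarrow> z \<in> nbrs E y \<Longrightarrow> z \<in> near E x"
  and nearI3: "y \<in> nbrs E x \<Longrightarrow> z \<in> nbrs E y \<Longrightarrow> w \<in> nbrs E z \<Longrightarrow> w \<in> near E x"
  by (auto simp: near_def)

lemma scattered_far: "scattered E T \<Longrightarrow> x \<in> T \<Longrightarrow> y \<in> T \<Longrightarrow> x \<noteq> y \<Longrightarrow> y \<notin> near E x"
  and scattered_no_triangle: "scattered E T \<Longrightarrow> x \<in> T \<Longrightarrow> \<not> in_triangle E x"
  by (auto simp: scattered_def)

abbreviation pairs :: "nat \<Rightarrow> nat set set" where
  "pairs n \<equiv> {e. e \<subseteq> {1..n} \<and> card e = 2}"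

lemma finite_pairs: "finite (pairs n)"
  by (rule finite_subset[of _ "Pow {1..n}"]) auto

lemma card_pairs: "card (pairs n) \<le> n\<^sup>2"
proof -
  have "card (pairs n) = n choose 2" by (subst n_subsets) auto
  also have "\<dots> \<le> n * (n - 1)" by (simp add: choose_two)
  also have "\<dots> \<le> n\<^sup>2" by (simp add: power2_eq_square)
  finally show ?thesis .
qed

context regular_graph
begin

lemma weight_eq:
  assumes "M \<subseteq> {1..n} - W" "v \<in> M"
  shows "weight E ({1..n} - W) M v = (\<Sum>u\<in>nbrs E v - W. if u \<in> M then 1 / 2 else 1)"
proof -
  have "{e. e \<in> touching E ({1..n} - W) M \<and> v \<in> e} = {e \<in> {e \<in> E. v \<in> e}. e \<subseteq> {1..n} - W}"
    using assms by (auto simp: touching_def)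
  also have "{e \<in> E. v \<in> e} = (\<lambda>u. {v, u}) ` nbrs E v"
    using edge_card by (rule edges_at_eq_image_nbrs)
  also have "{e \<in> (\<lambda>u. {v, u}) ` nbrs E v. e \<subseteq> {1..n} - W} = (\<lambda>u. {v, u}) ` (nbrs E v - W)"
    using nbrs_sub[of v] assms by auto
  finally have eq: "{e. e \<in> touching E ({1..n} - W) M \<and> v \<in> e} = (\<lambda>u. {v, u}) ` (nbrs E v - W)" .
  have "1 / real (card ({v, u} \<inter> M)) = (if u \<in> M then 1 / 2 else 1)" if "u \<in> nbrs E v - W" for u
  proof -
    have "u \<noteq> v" using that self_notin_nbrs[of E v, OF edge_card] by auto
    then show ?thesis using assms(2) by (cases "u \<in> M") auto
  qed
  then show ?thesis unfolding weight_def eq by (subst sum.reindex[OF inj_on_pair]) simp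
qed

text \<open>A vertex of \<open>M\<close> keeps at least \<open>d - 1 \<ge> 2\<close> neighbours,
  each worth at least 1/2. Its weight reaches 3/2 if it lost no neighbour or kept an unmoved one.
  Any other vertex of \<open>M\<close> has lost a neighbour and kept a moved one, which has lost
  none because \<open>T\<close> is scattered. So the closed neighbourhoods of the vertices of weight
  at least 3/2 cover \<open>M\<close>; each has \<open>d + 1\<close> vertices and brings an excess
  of at least 1/2.\<close>

lemma weight_bounds:
  assumes d: "d \<ge> 3" and T: "scattered E T" and W: "W \<subseteq> T" and M: "M \<subseteq> {1..n} - W"
  shows "\<And>v. v \<in> M \<Longrightarrow> 1 \<le> weight E ({1..n} - W) M v"
    and "1 / (2 * (real d + 1)) * real (card M) \<le> (\<Sum>v\<in>M. weight E ({1..n} - W) M v - 1)"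
proof -
  let ?w = "weight E ({1..n} - W) M"
  let ?N = "\<lambda>v. nbrs E v - W"
  have finM: "finite M" using M finite_subset by blast
  have cap: "card (nbrs E v \<inter> W) \<le> 1" for v
  proof -
    have "x = y" if "x \<in> nbrs E v \<inter> W" "y \<in> nbrs E v \<inter> W" for x y
      using that nearI2[of v E x y] nbrs_sym[of x E v] scattered_far[OF T, of x y] W by blast
    then show ?thesis using finite_nbrs by (metis card_le_Suc0_iff_eq finite_Int One_nat_def)
  qed
  have cN: "d - 1 \<le> card (?N v)" if "v \<in> M" for v
  proof -
    have "card (nbrs E v) = d" using that M card_nbrs by auto
    then show ?thesis
      using cap[of v] finite_nbrs card_Diff_subset_Int[of "nbrs E v" W] by simp
  qed
  have half: "real (card A) / 2 \<le> (\<Sum>u\<in>A. if u \<in> M then 1 / 2 else 1)" for A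
  proof -
    have "real (card A) / 2 = (\<Sum>u\<in>A. 1 / 2)" by simp
    also have "\<dots> \<le> (\<Sum>u\<in>A. if u \<in> M then 1 / 2 else 1)" by (rule sum_mono) auto
    finally show ?thesis .
  qed
  have w1: "1 \<le> ?w v" if v: "v \<in> M" for v
    using weight_eq[OF M v] half[of "?N v"] cN[OF v] d by simp
  show "\<And>v. v \<in> M \<Longrightarrow> 1 \<le> ?w v" by (rule w1)
  have wb: "3 / 2 \<le> ?w v" if v: "v \<in> M" "nbrs E v \<inter> W = {}" for v
  proof -
    have "?N v = nbrs E v" using v by auto
    moreover have "card (nbrs E v) = d" using v M card_nbrs by auto
    ultimately show ?thesis using weight_eq[OF M v(1)] half[of "?N v"] d by simp
  qed
  have wc: "3 / 2 \<le> ?w v" if v: "v \<in> M" "u \<in> ?N v" "u \<notin> M" for v u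
  proof -
    have fin: "finite (?N v)" using finite_nbrs by simp
    have "?w v = 1 + (\<Sum>u\<in>?N v - {u}. if u \<in> M then 1 / 2 else 1)"
      using weight_eq[OF M v(1)] v by (simp add: sum.remove[OF fin v(2)])
    moreover have "d - 2 \<le> card (?N v - {u})" using cN[OF v(1)] v(2) fin by simp
    ultimately show ?thesis using half[of "?N v - {u}"] d by simp
  qed
  define X where "X = {v \<in> M. 3 / 2 \<le> ?w v}"
  have cover: "M \<subseteq> (\<Union>x\<in>X. insert x (nbrs E x))"
  proof
    fix v assume v: "v \<in> M"
    show "v \<in> (\<Union>x\<in>X. insert x (nbrs E x))"
    proof (cases "v \<in> X")
      case False
      then have lt: "\<not> 3 / 2 \<le> ?w v" using v by (simp add: X_def)
      then obtain t where t: "t \<in> W" "t \<in> nbrs E v" using wb[OF v] by auto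
      have "card (?N v) \<noteq> 0" using cN[OF v] d by simp
      then obtain u where u: "u \<in> ?N v" by (metis card.empty ex_in_conv)
      then have uM: "u \<in> M" using wc[OF v] lt by blast
      have "nbrs E u \<inter> W = {}"
      proof (rule ccontr)
        assume "nbrs E u \<inter> W \<noteq> {}"
        then obtain w where w: "w \<in> nbrs E u" "w \<in> W" by auto
        show False
        proof (cases "w = t")
          case True
          have "{t, v} \<in> E" "{t, u} \<in> E" "{v, u} \<in> E"
            using t w u True by (auto simp: nbrs_def insert_commute)
          then have "in_triangle E t" unfolding in_triangle_def by blast
          then show False using scattered_no_triangle[OF T] t W by blast
        next
          case False
          have "w \<in> near E t"
            using nearI3[of v E t u w] t u w nbrs_sym[of t E v] by auto
          then show False using scattered_far[OF T, of t w] False t w W by blast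
        qed
      qed
      then have "u \<in> X" using wb[OF uM] uM by (simp add: X_def)
      then show ?thesis using u nbrs_sym[of u E v] by auto
    qed auto
  qed
  have finX: "finite X" using finM by (simp add: X_def)
  have "card M \<le> card (\<Union>x\<in>X. insert x (nbrs E x))"
    using finX finite_nbrs cover by (intro card_mono) auto
  also have "\<dots> \<le> (\<Sum>x\<in>X. card (insert x (nbrs E x)))" by (rule card_UN_le[OF finX])
  also have "\<dots> \<le> (\<Sum>x\<in>X. d + 1)"
  proof (rule sum_mono)
    fix x assume "x \<in> X"
    then have "card (nbrs E x) = d" using M by (intro card_nbrs) (auto simp: X_def)
    then show "card (insert x (nbrs E x)) \<le> d + 1" by (simp add: card_insert_if finite_nbrs)
  qed
  finally have "card M \<le> card X * (d + 1)" by simp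
  then have "real (card M) \<le> real (card X) * (real d + 1)"
    by (metis of_nat_1 of_nat_add of_nat_le_iff of_nat_mult)
  then have "1 / (2 * (real d + 1)) * real (card M) \<le> real (card X) * (1 / 2)"
    by (simp add: field_simps)
  also have "\<dots> = (\<Sum>v\<in>X. 1 / 2)" by simp
  also have "\<dots> \<le> (\<Sum>v\<in>X. ?w v - 1)" by (intro sum_mono) (auto simp: X_def)
  also have "\<dots> \<le> (\<Sum>v\<in>M. ?w v - 1)"
    using finM w1 by (intro sum_mono2) (auto simp: X_def)
  finally show "1 / (2 * (real d + 1)) * real (card M) \<le> (\<Sum>v\<in>M. ?w v - 1)" .
qed

end

text \<open>\<open>U\<close>, \<open>M\<close>, \<open>R\<close> and \<open>B\<close> cost bits
  only; \<open>B\<close> marks the antipodal edges. \<open>g\<close> is \<open>f\<close> off the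
  representatives, and on a genuine code \<open>SOME\<close> recovers \<open>f\<close>, as
  \<open>eq_on_if_eq_off_cycle_reps\<close> leaves just one candidate.\<close>

definition decode :: "nat \<Rightarrow> (nat set \<times> nat set \<times> nat set \<times> nat set) \<times> (nat \<Rightarrow> nat) \<times> nat set set \<Rightarrow> nat ugraph" where
  "decode n = (\<lambda>((U, M, R, B), g, D).
     let f = (SOME f. inj_on f M \<and> cycle_reps f M R \<and> (\<forall>y\<in>M - R. f y = g y) \<and> (\<forall>x. x \<notin> M \<longrightarrow> f x = x))
     in ({1..n}, unfold_edges f U (D \<union> (\<lambda>x. {x, antipode f x}) ` B)))"

text \<open>\<open>f\<close> embeds \<open>G - W\<close> as an induced subgraph of \<open>G\<close>.
  Leaving the image open covers isomorphisms onto every \<open>G - W'\<close>.\<close>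

definition partially_symmetric :: "nat \<Rightarrow> nat \<Rightarrow> real \<Rightarrow> nat ugraph set" where
  "partially_symmetric n d \<epsilon> = {G \<in> regular_graphs n d. \<exists>T W f.
     scattered (edges G) T \<and> W \<subseteq> T \<and> inj_on f ({1..n} - W) \<and> f ` ({1..n} - W) \<subseteq> {1..n} \<and>
     (\<forall>x\<in>{1..n} - W. \<forall>y\<in>{1..n} - W. {x, y} \<in> edges G \<longleftrightarrow> {f x, f y} \<in> edges G) \<and>
     \<epsilon> * real n \<le> real (card {x \<in> {1..n} - W. f x \<noteq> x})}"

text \<open>Each moved vertex saves half of the average excess \<open>1 / (2 * (d + 1))\<close> from
  \<open>weight_bounds\<close>, and at least \<open>\<epsilon> * n\<close> vertices move. Being
  strictly below \<open>K + 1\<close>, the whole number of labels is at most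
  \<open>K\<close>.\<close>

lemma partially_symmetric_subset_decode:
  assumes d: "d \<ge> 3"
    and K: "real d * real n / 2 - \<epsilon> / (4 * (real d + 1)) * real n < real K + 1"
  shows "partially_symmetric n d \<epsilon> \<subseteq> decode n `
    (SIGMA i:Pow {1..n} \<times> Pow {1..n} \<times> Pow {1..n} \<times> Pow {1..n}.
      (case i of (U, M, R, B) \<Rightarrow> (M - R) \<rightarrow>\<^sub>E {1..n}) \<times>
      {D. D \<subseteq> pairs n \<and> (case i of (U, M, R, B) \<Rightarrow> card (M - R)) + card D \<le> K})"
proof
  fix G assume G: "G \<in> partially_symmetric n d \<epsilon>"
  then obtain T W f0 where T: "scattered (edges G) T" and W: "W \<subseteq> T"
    and f0: "inj_on f0 ({1..n} - W)" "f0 ` ({1..n} - W) \<subseteq> {1..n}"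
      "\<forall>x\<in>{1..n} - W. \<forall>y\<in>{1..n} - W. {x, y} \<in> edges G \<longleftrightarrow> {f0 x, f0 y} \<in> edges G"
      "\<epsilon> * real n \<le> real (card {x \<in> {1..n} - W. f0 x \<noteq> x})"
    unfolding partially_symmetric_def by auto
  define E where "E = edges G"
  interpret regular_graph n d G E
    using G by unfold_locales (auto simp: partially_symmetric_def E_def)
  define U where "U = {1..n} - W"
  \<comment> \<open>Extension by the identity, so that \<open>moved\<close> holds at every
    point.\<close>
  define f where "f x = (if x \<in> U then f0 x else x)" for x
  define M where "M = {x \<in> U. f0 x \<noteq> x}"
  interpret partial_iso E U M f
  proof
    show "finite E" by (rule finite_E)
    show "card e = 2" if "e \<in> E" for e using that by (rule edge_card)
    show "finite U" by (simp add: U_def)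
    show "M \<subseteq> U" by (auto simp: M_def)
    show "inj_on f U" using f0(1) by (auto simp: inj_on_def f_def U_def)
    show "x \<in> M \<longleftrightarrow> f x \<noteq> x" for x by (auto simp: M_def f_def)
    show "{x, y} \<in> E \<longleftrightarrow> {f x, f y} \<in> E" if "x \<in> U" "y \<in> U" for x y
      using that f0(3) by (simp add: f_def U_def E_def)
  qed
  have Mn: "M \<subseteq> {1..n} - W" by (auto simp: M_def U_def)
  note wb = weight_bounds[OF d T[folded E_def] W Mn, folded U_def]
  obtain R D where R: "cycle_reps f M R" "R \<subseteq> M" and D: "D \<subseteq> E"
    and dec: "unfold_edges f U (D \<union> (\<lambda>x. {x, antipode f x}) ` {x. {x, antipode f x} \<in> E}) = E"
    and size: "real (card (M - R)) + real (card D) \<le> real (card E) - 1 / (2 * (real d + 1)) / 2 * real (card M)"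
    by (rule ex_code[OF wb])
  define B where "B = {x. {x, antipode f x} \<in> E}"
  have Bn: "B \<subseteq> {1..n}" using edge_sub by (force simp: B_def)
  define g where "g = restrict f (M - R)"
  have fM: "f ` M \<subseteq> {1..n}" using f0(2) by (auto simp: M_def f_def U_def)
  have fin: "inj_on f M \<and> cycle_reps f M R \<and> (\<forall>y\<in>M - R. f y = g y) \<and> (\<forall>x. x \<notin> M \<longrightarrow> f x = x)"
    using inj_f_M R moved by (simp add: g_def)
  have unique: "f' = f" if f': "inj_on f' M \<and> cycle_reps f' M R \<and> (\<forall>y\<in>M - R. f' y = g y) \<and> (\<forall>x. x \<notin> M \<longrightarrow> f' x = x)" for f'
  proof
    fix x
    show "f' x = f x"
    proof (cases "x \<in> M")
      case True
      show ?thesis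
        by (rule eq_on_if_eq_off_cycle_reps[of f' M f R x]) (use f' fin True in auto)
    qed (use f' fin in auto)
  qed
  have some: "(SOME f. inj_on f M \<and> cycle_reps f M R \<and> (\<forall>y\<in>M - R. f y = g y) \<and> (\<forall>x. x \<notin> M \<longrightarrow> f x = x)) = f"
    using fin unique by (rule some_equality)
  have "decode n ((U, M, R, B), g, D) = G"
    unfolding decode_def by (simp add: Let_def some B_def dec G_eq)
  moreover have "card (M - R) + card D \<le> K"
  proof -
    have "\<epsilon> / (4 * (real d + 1)) * real n \<le> 1 / (2 * (real d + 1)) / 2 * real (card M)"
    proof -
      have "1 / (4 * (real d + 1)) * (\<epsilon> * real n) \<le> 1 / (4 * (real d + 1)) * real (card M)"
        using f0(4) by (intro mult_left_mono) (auto simp: M_def U_def)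
      then show ?thesis by (simp add: field_simps)
    qed
    moreover have "real (card E) = real d * real n / 2"
      using card_E by (metis mult.commute nonzero_mult_div_cancel_left of_nat_mult of_nat_numeral zero_neq_numeral)
    ultimately have "real (card (M - R) + card D) < real K + 1" using size K by simp
    then show ?thesis by linarith
  qed
  moreover have "g \<in> (M - R) \<rightarrow>\<^sub>E {1..n}" using fM by (auto simp: g_def)
  moreover have "D \<subseteq> pairs n" using D edge_card edge_sub by auto
  moreover have "U \<subseteq> {1..n}" "M \<subseteq> {1..n}" "R \<subseteq> {1..n}" using R Mn by (auto simp: U_def)
  ultimately show "G \<in> decode n `
    (SIGMA i:Pow {1..n} \<times> Pow {1..n} \<times> Pow {1..n} \<times> Pow {1..n}.
      (case i of (U, M, R, B) \<Rightarrow> (M - R) \<rightarrow>\<^sub>E {1..n}) \<times>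
      {D. D \<subseteq> pairs n \<and> (case i of (U, M, R, B) \<Rightarrow> card (M - R)) + card D \<le> K})"
    using Bn by (intro image_eqI[of _ _ "((U, M, R, B), g, D)"]) auto
qed

lemma power_floor_le_powr:
  assumes "n \<ge> 1" "0 \<le> y"
  shows "real n ^ nat \<lfloor>y\<rfloor> \<le> real n powr y"
proof -
  have "real n ^ nat \<lfloor>y\<rfloor> = real n powr real (nat \<lfloor>y\<rfloor>)" using assms(1) by (intro powr_realpow[symmetric]) simp
  also have "\<dots> \<le> real n powr y" using assms by (intro powr_mono) auto
  finally show ?thesis .
qed

lemma card_partially_symmetric:
  assumes d: "d \<ge> 3" and n: "n \<ge> 1" and \<epsilon>: "\<epsilon> \<le> 1"
  shows "real (card (partially_symmetric n d \<epsilon>))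
    \<le> 16 ^ n * real n powr ((real d / 2 - \<epsilon> / (4 * (real d + 1))) * real n) * exp (real n)"
proof -
  define y where "y = (real d / 2 - \<epsilon> / (4 * (real d + 1))) * real n"
  define K where "K = nat \<lfloor>y\<rfloor>"
  have "\<epsilon> / (4 * (real d + 1)) \<le> 1"
  proof -
    have "\<epsilon> / (4 * (real d + 1)) \<le> 1 / (4 * (real d + 1))" using \<epsilon> by (intro divide_right_mono) auto
    also have "\<dots> \<le> 1" by (simp add: field_simps)
    finally show ?thesis .
  qed
  then have "0 \<le> real d / 2 - \<epsilon> / (4 * (real d + 1))" using d by linarith
  then have y0: "0 \<le> y" unfolding y_def by (rule mult_nonneg_nonneg) simp
  let ?I = "Pow {1..n} \<times> Pow {1..n} \<times> Pow {1..n} \<times> Pow {1..n}"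
  let ?H = "\<lambda>i::nat set \<times> nat set \<times> nat set \<times> nat set. case i of (U, M, R, B) \<Rightarrow> (M - R) \<rightarrow>\<^sub>E {1..n}"
  let ?h = "\<lambda>i::nat set \<times> nat set \<times> nat set \<times> nat set. case i of (U, M, R, B) \<Rightarrow> card (M - R)"
  let ?C = "SIGMA i:?I. ?H i \<times> {D. D \<subseteq> pairs n \<and> ?h i + card D \<le> K}"
  have HI: "finite (?H i) \<and> card (?H i) \<le> n ^ ?h i" if "i \<in> ?I" for i
    using that by (auto simp: card_PiE finite_subset split: prod.splits intro!: finite_PiE)
  note codes = card_codes_le[of ?I ?H n ?h "pairs n" K, OF _ HI finite_pairs n card_pairs]
  have "y < real K + 1" using y0 unfolding K_def by linarith
  then have "partially_symmetric n d \<epsilon> \<subseteq> decode n ` ?C"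
    using d by (intro partially_symmetric_subset_decode) (simp_all add: y_def left_diff_distrib)
  then have "card (partially_symmetric n d \<epsilon>) \<le> card ?C"
    using codes(1) by (intro surj_card_le) auto
  then have "real (card (partially_symmetric n d \<epsilon>)) \<le> real (card ?C)" by simp
  also have "\<dots> \<le> real (card ?I) * real n ^ K * exp (real n)" using codes(2) by simp
  also have "real (card ?I) = 16 ^ n"
  proof -
    have "card ?I = 2 ^ n * (2 ^ n * (2 ^ n * 2 ^ n))" by (simp add: card_cartesian_product card_Pow)
    also have "\<dots> = 16 ^ n" by (simp flip: power_mult_distrib)
    finally show ?thesis by simp
  qed
  also have "real n ^ K \<le> real n powr y" unfolding K_def using n y0 by (rule power_floor_le_powr)
  finally show ?thesis by (simp add: y_def)
qed

section \<open>Compression of graphs with many triangles\<close>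

definition triangle_rich :: "nat \<Rightarrow> nat \<Rightarrow> nat ugraph set" where
  "triangle_rich n d = {G \<in> regular_graphs n d. n \<le> 2 * card {v \<in> {1..n}. in_triangle (edges G) v}}"

definition decode_triangles :: "nat \<Rightarrow> nat set \<times> ((nat \<Rightarrow> nat) \<times> (nat \<Rightarrow> nat)) \<times> nat set set \<Rightarrow> nat ugraph" where
  "decode_triangles n = (\<lambda>(Q, (a, b), D).
     ({1..n}, D \<union> (\<Union>q\<in>Q. {{q, a q}, {q, b q}, {a q, b q}})))"

text \<open>Choose far-apart vertices lying in triangles. Their triangles share no edge, and naming
  the two other corners replaces three edges, saving one label each. The greedy factor is at most
  \<open>4 * d ^ 3\<close>, doubled since half of the vertices are guaranteed to lie in
  triangles.\<close>

lemma triangle_rich_subset_decode: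
  assumes d: "d \<ge> 1"
    and K: "real d * real n / 2 - real n / (8 * real d ^ 3) < real K + 1"
  shows "triangle_rich n d \<subseteq> decode_triangles n `
    (SIGMA Q:Pow {1..n}. ((Q \<rightarrow>\<^sub>E {1..n}) \<times> (Q \<rightarrow>\<^sub>E {1..n})) \<times> {D. D \<subseteq> pairs n \<and> 2 * card Q + card D \<le> K})"
proof
  fix G assume rich: "G \<in> triangle_rich n d"
  define E where "E = edges G"
  interpret regular_graph n d G E
    using rich by unfold_locales (auto simp: triangle_rich_def E_def)
  define A where "A = {v \<in> {1..n}. in_triangle E v}"
  have nA: "n \<le> 2 * card A" using rich unfolding triangle_rich_def A_def E_def by blast
  have "A \<subseteq> {1..n}" by (auto simp: A_def)
  then obtain Q where Q: "Q \<subseteq> A" and far: "\<And>x y. x \<in> Q \<Longrightarrow> y \<in> Q \<Longrightarrow> x \<noteq> y \<Longrightarrow> y \<notin> near E x"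
    and cQ: "card A \<le> (d + d * d + d * d * d + 1) * card Q"
    by (rule ex_far_apart) blast
  have Qn: "Q \<subseteq> {1..n}" using Q by (auto simp: A_def)
  have finQ: "finite Q" using Qn finite_subset by blast
  have "\<forall>q\<in>Q. \<exists>a b. {q, a} \<in> E \<and> {q, b} \<in> E \<and> {a, b} \<in> E"
    using Q by (auto simp: A_def in_triangle_def)
  then obtain a b where ab: "\<And>q. q \<in> Q \<Longrightarrow> {q, a q} \<in> E \<and> {q, b q} \<in> E \<and> {a q, b q} \<in> E"
    by metis
  define t where "t q = {{q, a q}, {q, b q}, {a q, b q}}" for q
  have tE: "t q \<subseteq> E" if "q \<in> Q" for q using ab[OF that] by (auto simp: t_def)
  have t3: "card (t q) = 3" if "q \<in> Q" for q
  proof -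
    have "q \<noteq> a q" "q \<noteq> b q" "a q \<noteq> b q"
      using ab[OF that] edge_card[of "{q, a q}"] edge_card[of "{q, b q}"] edge_card[of "{a q, b q}"]
      by (auto simp: card_insert_if split: if_splits)
    then show ?thesis by (auto simp: t_def doubleton_eq_iff)
  qed
  have close: "x \<in> insert q (nbrs E q)" if "q \<in> Q" "e \<in> t q" "x \<in> e" for q e x
    using that ab[OF that(1)] by (auto simp: t_def nbrs_def)
  \<comment> \<open>An end of a shared edge is within one step of both \<open>q\<close> and
    \<open>q'\<close>, which puts these at distance at most two.\<close>
  have disj: "t q \<inter> t q' = {}" if q: "q \<in> Q" "q' \<in> Q" "q \<noteq> q'" for q q'
  proof (rule ccontr)
    assume "t q \<inter> t q' \<noteq> {}"
    then obtain e where e: "e \<in> t q" "e \<in> t q'" by auto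
    have "card e = 2" using e tE[OF q(1)] edge_card by auto
    then obtain x where "x \<in> e" by fastforce
    then have x: "x \<in> insert q (nbrs E q)" "x \<in> insert q' (nbrs E q')"
      using close e q by auto
    then have "q' \<in> near E q"
      using q(3) nearI1[of q' E q] nearI2[of x E q q'] nbrs_sym[of q E q'] nbrs_sym[of x E q']
      by auto
    then show False using far q by auto
  qed
  define X where "X = (\<Union>q\<in>Q. t q)"
  have XE: "X \<subseteq> E" using tE by (auto simp: X_def)
  have "card X = (\<Sum>q\<in>Q. card (t q))"
    unfolding X_def using finQ disj by (intro card_UN_disjoint) (auto simp: t_def)
  then have cX: "card X = 3 * card Q" using t3 by simp
  define D where "D = E - X"
  have "card D = card E - card X"
    unfolding D_def using XE finite_E by (intro card_Diff_subset) (auto intro: finite_subset)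
  moreover have "card X \<le> card E" using XE finite_E by (rule card_mono[rotated])
  ultimately have cD: "card D + 3 * card Q = card E" using cX by simp
  have "a q \<in> {1..n}" "b q \<in> {1..n}" if "q \<in> Q" for q
    using ab[OF that] edge_sub[of "{q, a q}"] edge_sub[of "{q, b q}"] by auto
  then have "(restrict a Q, restrict b Q) \<in> (Q \<rightarrow>\<^sub>E {1..n}) \<times> (Q \<rightarrow>\<^sub>E {1..n})" by auto
  moreover have "decode_triangles n (Q, (restrict a Q, restrict b Q), D) = G"
  proof -
    have "(\<Union>q\<in>Q. {{q, restrict a Q q}, {q, restrict b Q q}, {restrict a Q q, restrict b Q q}}) = X"
      unfolding X_def t_def by (intro SUP_cong) auto
    then show ?thesis using XE by (auto simp: decode_triangles_def G_eq D_def)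
  qed
  moreover have "2 * card Q + card D \<le> K"
  proof -
    have "d + d * d + d * d * d + 1 \<le> 4 * d ^ 3"
    proof -
      have "1 \<le> d * d * d" "d \<le> d * d * d" "d * d \<le> d * d * d" using d by auto
      then show ?thesis unfolding power3_eq_cube by linarith
    qed
    then have "card A \<le> 4 * d ^ 3 * card Q" using cQ by (meson le_trans mult_le_mono1)
    then have "n \<le> 8 * d ^ 3 * card Q" using nA by simp
    then have "real n \<le> real (8 * d ^ 3 * card Q)" by (simp only: of_nat_le_iff)
    then have "real n / (8 * real d ^ 3) \<le> real (card Q)" using d by (simp add: field_simps)
    moreover have "real (2 * card E) = real (d * n)" by (simp only: card_E)
    moreover have "real (card D) + 3 * real (card Q) = real (card E)"
      using cD by (metis of_nat_add of_nat_mult of_nat_numeral)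
    ultimately have "real (2 * card Q + card D) < real K + 1" using K by simp
    then show ?thesis by linarith
  qed
  moreover have "D \<subseteq> pairs n" using edge_card edge_sub by (auto simp: D_def)
  ultimately show "G \<in> decode_triangles n `
    (SIGMA Q:Pow {1..n}. ((Q \<rightarrow>\<^sub>E {1..n}) \<times> (Q \<rightarrow>\<^sub>E {1..n})) \<times> {D. D \<subseteq> pairs n \<and> 2 * card Q + card D \<le> K})"
    using Qn by (intro image_eqI[of _ _ "(Q, (restrict a Q, restrict b Q), D)"]) auto
qed

lemma card_triangle_rich:
  assumes d: "d \<ge> 1" and n: "n \<ge> 1"
  shows "real (card (triangle_rich n d))
    \<le> 2 ^ n * real n powr ((real d / 2 - 1 / (8 * real d ^ 3)) * real n) * exp (real n)"
proof -
  define y where "y = (real d / 2 - 1 / (8 * real d ^ 3)) * real n"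
  define K where "K = nat \<lfloor>y\<rfloor>"
  have "1 / (8 * real d ^ 3) \<le> real d / 2"
  proof -
    have "1 / (8 * real d ^ 3) \<le> 1 / 8" using d by (simp add: field_simps)
    also have "\<dots> \<le> real d / 2" using d by simp
    finally show ?thesis .
  qed
  then have y0: "0 \<le> y" unfolding y_def by (intro mult_nonneg_nonneg) auto
  let ?H = "\<lambda>Q. (Q \<rightarrow>\<^sub>E {1..n}) \<times> (Q \<rightarrow>\<^sub>E {1..n})"
  let ?C = "SIGMA Q:Pow {1..n}. ?H Q \<times> {D. D \<subseteq> pairs n \<and> 2 * card Q + card D \<le> K}"
  have HI: "finite (?H Q) \<and> card (?H Q) \<le> n ^ (2 * card Q)" if "Q \<in> Pow {1..n}" for Q
  proof -
    have fQ: "finite Q" using that finite_subset by auto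
    then have "card (?H Q) = n ^ card Q * n ^ card Q"
      by (simp add: card_cartesian_product card_PiE)
    then show ?thesis using fQ by (auto simp: mult_2 power_add intro!: finite_PiE)
  qed
  note codes = card_codes_le[of "Pow {1..n}" ?H n "\<lambda>Q. 2 * card Q" "pairs n" K, OF _ HI finite_pairs n card_pairs]
  have "y < real K + 1" using y0 unfolding K_def by linarith
  then have "triangle_rich n d \<subseteq> decode_triangles n ` ?C"
    using d by (intro triangle_rich_subset_decode) (simp_all add: y_def left_diff_distrib)
  then have "card (triangle_rich n d) \<le> card ?C"
    using codes(1) by (intro surj_card_le) auto
  then have "real (card (triangle_rich n d)) \<le> real (card ?C)" by simp
  also have "\<dots> \<le> real (card (Pow {1..n})) * real n ^ K * exp (real n)" using codes(2) by simp
  also have "real (card (Pow {1..n})) = 2 ^ n" by (simp add: card_Pow)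
  also have "real n ^ K \<le> real n powr y" unfolding K_def using n y0 by (rule power_floor_le_powr)
  finally show ?thesis by (simp add: y_def)
qed

subsection \<open>Non-isomorphic induced subgraphs\<close>

text \<open>A vertex of \<open>W' - W\<close> lies in the domain of the isomorphism but not in its
  image, so it is moved; a vertex of \<open>W - W'\<close> lies in the image only, so it is the
  image of a moved vertex. Fewer than \<open>\<epsilon> * n\<close> vertices are moved.\<close>

lemma (in regular_graph) card_symdiff_le:
  assumes T: "scattered E T" "W \<subseteq> T" "W' \<subseteq> T" "T \<subseteq> {1..n}"
    and ns: "G \<notin> partially_symmetric n d \<epsilon>"
    and iso: "graph_iso (induced G ({1..n} - W)) (induced G ({1..n} - W'))"
  shows "real (card ((W - W') \<union> (W' - W))) \<le> 2 * \<epsilon> * real n"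
proof -
  let ?U = "{1..n} - W" and ?U' = "{1..n} - W'"
  obtain f where f: "bij_betw f ?U ?U'"
    and ef: "\<And>u v. u \<in> ?U \<Longrightarrow> v \<in> ?U \<Longrightarrow>
      {u, v} \<in> edges (induced G ?U) \<longleftrightarrow> {f u, f v} \<in> edges (induced G ?U')"
    using iso by (auto simp: graph_iso_def induced_def)
  have fU: "f u \<in> ?U'" if "u \<in> ?U" for u using f that bij_betwE by blast
  have ed: "{u, v} \<in> E \<longleftrightarrow> {f u, f v} \<in> E" if "u \<in> ?U" "v \<in> ?U" for u v
    using ef[OF that] that fU[OF that(1)] fU[OF that(2)] by (simp add: induced_def E_def)
  define M where "M = {x \<in> ?U. f x \<noteq> x}"
  have "\<not> \<epsilon> * real n \<le> real (card M)"
  proof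
    assume "\<epsilon> * real n \<le> real (card M)"
    moreover have "inj_on f ?U" "f ` ?U \<subseteq> {1..n}" using f by (auto simp: bij_betw_def)
    ultimately have "G \<in> partially_symmetric n d \<epsilon>"
      using G T(1,2) ed unfolding partially_symmetric_def M_def E_def by blast
    then show False using ns by simp
  qed
  moreover have "card ((W - W') \<union> (W' - W)) \<le> 2 * card M"
  proof -
    have finM: "finite M" by (simp add: M_def)
    have "W' - W \<subseteq> M" using T fU by (auto simp: M_def) (metis Diff_iff atLeastAtMost_iff subsetD fU)
    moreover have "W - W' \<subseteq> f ` M"
    proof
      fix x assume x: "x \<in> W - W'"
      then have "x \<in> f ` ?U" using f T by (auto simp: bij_betw_def)
      then show "x \<in> f ` M" using x by (auto simp: M_def)
    qed
    ultimately have "card ((W - W') \<union> (W' - W)) \<le> card (f ` M \<union> M)"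
      using finM by (intro card_mono) auto
    also have "\<dots> \<le> card (f ` M) + card M" by (rule card_Un_le)
    also have "\<dots> \<le> 2 * card M" using card_image_le[OF finM, of f] by simp
    finally show ?thesis .
  qed
  ultimately show ?thesis by linarith
qed

lemma card_le_mult_fibre:
  assumes "finite B" "f ` A \<subseteq> B" "\<And>y. y \<in> B \<Longrightarrow> card {x \<in> A. f x = y} \<le> k"
  shows "card A \<le> card B * k"
proof -
  have "A = (\<Union>y\<in>B. {x \<in> A. f x = y})" using assms(2) by auto
  then have "card A \<le> (\<Sum>y\<in>B. card {x \<in> A. f x = y})" using card_UN_le[OF assms(1)] by metis
  also have "\<dots> \<le> (\<Sum>y\<in>B. k)" using assms(3) by (rule sum_mono)
  finally show ?thesis by simp
qed

text \<open>With \<open>N = card T\<close>, the sets \<open>W \<subseteq> T\<close> giving one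
  isomorphism class lie in a Hamming ball of radius \<open>N div 8\<close> about any of them. Such a
  ball has at most \<open>2 powr (3 * N / 4)\<close> of the \<open>2 ^ N\<close> members.\<close>

lemma (in regular_graph) mu_ge:
  assumes T: "scattered E T" "T \<subseteq> {1..n}"
    and ns: "G \<notin> partially_symmetric n d \<epsilon>"
    and \<epsilon>: "16 * \<epsilon> * real n \<le> real (card T)"
  shows "2 powr (real (card T) / 4) \<le> real (mu G)"
proof -
  define S where "S = induced_subgraphs G"
  define N where "N = card T"
  define q where "q = N div 8"
  define ball where "ball = card {D. D \<subseteq> T \<and> card D \<le> q}"
  let ?H = "\<lambda>W. induced G ({1..n} - W)"
  let ?cls = "\<lambda>W. iso_rel S `` {?H W}"
  have finT: "finite T" using T finite_subset by blast
  have HS: "?H W \<in> S" for W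
    unfolding S_def induced_subgraphs_def by (rule imageI) (simp add: G_eq)
  have finS: "finite S" by (simp add: S_def induced_subgraphs_def G_eq)
  have "card (Pow T) \<le> card (S // iso_rel S) * ball"
  proof (rule card_le_mult_fibre[of _ ?cls])
    show "finite (S // iso_rel S)" using finS by (simp add: quotient_def)
    show "?cls ` Pow T \<subseteq> S // iso_rel S" using HS by (auto intro: quotientI)
    fix c
    show "card {W \<in> Pow T. ?cls W = c} \<le> ball"
    proof (cases "{W \<in> Pow T. ?cls W = c} = {}")
      case True
      show ?thesis unfolding True by simp
    next
      case False
      then obtain V where V: "V \<subseteq> T" "?cls V = c" by auto
      let ?sd = "\<lambda>W. (V - W) \<union> (W - V)"
      have "inj_on ?sd {W \<in> Pow T. ?cls W = c}" by (rule inj_onI) blast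
      moreover have "?sd ` {W \<in> Pow T. ?cls W = c} \<subseteq> {D. D \<subseteq> T \<and> card D \<le> q}"
      proof (intro image_subsetI CollectI conjI)
        fix W assume W: "W \<in> {W \<in> Pow T. ?cls W = c}"
        then show "?sd W \<subseteq> T" using V by auto
        have "(?H V, ?H W) \<in> iso_rel S"
          using eq_equiv_class_iff[OF equiv_iso_rel HS HS, of V W] V W by blast
        then have "graph_iso (?H V) (?H W)" by (simp add: iso_rel_def)
        then have "real (card (?sd W)) \<le> 2 * \<epsilon> * real n"
          using card_symdiff_le T V W ns by simp
        then have "8 * real (card (?sd W)) \<le> real N" using \<epsilon> by (simp add: N_def)
        then show "card (?sd W) \<le> q" unfolding q_def by linarith
      qed
      ultimately show ?thesis unfolding ball_def using finT by (intro card_inj_on_le) auto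
    qed
  qed
  then have "real (2 ^ N) \<le> real (mu G * ball)"
    using finT unfolding of_nat_le_iff by (simp add: card_Pow mu_def S_def N_def)
  then have 1: "2 ^ N \<le> real (mu G) * real ball" by simp
  \<comment> \<open>The choice \<open>x = 1 / 4\<close> bounds the ball by
    \<open>(5 / 4) ^ N * 4 ^ q\<close>; then \<open>5 / 4 \<le> sqrt 2\<close> and
    \<open>q \<le> N / 8\<close> suffice.\<close>
  have "real ball * (1 / 4) ^ q \<le> (1 + 1 / 4) ^ card T"
    unfolding ball_def using finT by (intro card_small_subsets_le) auto
  then have 2: "real ball \<le> (5 / 4) ^ N * 4 ^ q" by (simp add: N_def field_simps)
  have "(5 / 4 :: real) ^ N \<le> (2 powr (1 / 2)) ^ N"
  proof (intro power_mono)
    have "5 / 4 \<le> sqrt 2" by (rule real_le_rsqrt) (simp add: power2_eq_square)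
    then show "5 / 4 \<le> (2::real) powr (1 / 2)" by (simp add: powr_half_sqrt)
  qed simp
  also have "\<dots> = 2 powr (real N / 2)" by (simp add: powr_powr flip: powr_realpow)
  finally have 3: "(5 / 4 :: real) ^ N \<le> 2 powr (real N / 2)" .
  have "(4::real) ^ q = 2 powr (2 * real q)"
    by (simp add: powr_realpow flip: powr_powr)
  also have "\<dots> \<le> 2 powr (real N / 4)" by (intro powr_mono) (auto simp: q_def)
  finally have "(5 / 4) ^ N * 4 ^ q \<le> 2 powr (real N / 2) * 2 powr (real N / 4)"
    using 3 by (intro mult_mono) auto
  with 2 have "real ball \<le> 2 powr (real N / 2 + real N / 4)" unfolding powr_add by linarith
  then have "real (mu G) * real ball \<le> real (mu G) * 2 powr (real N / 2 + real N / 4)"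
    by (rule mult_left_mono) simp
  with 1 have "2 powr (real N) \<le> real (mu G) * 2 powr (real N / 2 + real N / 4)"
    by (simp add: powr_realpow)
  also have "2 powr (real N) = 2 powr (real N / 4) * 2 powr (real N / 2 + real N / 4)"
    by (simp flip: powr_add)
  finally show ?thesis by (simp add: N_def)
qed

subsection \<open>The number of regular graphs\<close>

text \<open>The shift by \<open>Suc\<close> allows adjacency to be described on
  \<open>{..<n}\<close>, where \<open>div\<close> and \<open>mod\<close> are convenient.\<close>

definition graph_of :: "nat \<Rightarrow> (nat \<Rightarrow> nat \<Rightarrow> bool) \<Rightarrow> nat ugraph" where
  "graph_of n adj = ({1..n}, {{Suc x, Suc y} | x y. x < n \<and> y < n \<and> adj x y})"

lemma edge_graph_of_iff:
  assumes "\<And>x y. x < n \<Longrightarrow> y < n \<Longrightarrow> adj x y \<Longrightarrow> adj y x" "x < n" "y < n"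
  shows "{Suc x, Suc y} \<in> edges (graph_of n adj) \<longleftrightarrow> adj x y"
  using assms by (auto simp: graph_of_def doubleton_eq_iff)

lemma graph_of_regular:
  assumes sym: "\<And>x y. x < n \<Longrightarrow> y < n \<Longrightarrow> adj x y \<Longrightarrow> adj y x"
    and irr: "\<And>x. x < n \<Longrightarrow> \<not> adj x x"
    and deg: "\<And>x. x < n \<Longrightarrow> card {y. y < n \<and> adj x y} = d"
  shows "graph_of n adj \<in> regular_graphs n d"
proof -
  let ?E = "edges (graph_of n adj)"
  have two: "card e = 2" if "e \<in> ?E" for e
    using that irr by (auto simp: graph_of_def card_insert_if)
  have sub: "e \<subseteq> {1..n}" if "e \<in> ?E" for e
    using that by (auto simp: graph_of_def)
  have "graph_degree (graph_of n adj) v = d" if v: "v \<in> {1..n}" for v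
  proof -
    obtain x where x: "v = Suc x" "x < n" using v by (cases v) auto
    have "nbrs ?E v = Suc ` {y. y < n \<and> adj x y}"
    proof (intro equalityI subsetI)
      fix u assume "u \<in> nbrs ?E v"
      then have e: "{v, u} \<in> ?E" by (simp add: nbrs_def)
      then have "u \<in> {1..n}" using sub by blast
      then obtain y where "u = Suc y" "y < n" by (cases u) auto
      then show "u \<in> Suc ` {y. y < n \<and> adj x y}"
        using e x edge_graph_of_iff[of n adj x y, OF sym] by simp
    next
      fix u assume "u \<in> Suc ` {y. y < n \<and> adj x y}"
      then show "u \<in> nbrs ?E v"
        using x edge_graph_of_iff[of n adj, OF sym] by (auto simp: nbrs_def)
    qed
    then have "card (nbrs ?E v) = d" using deg x by (simp add: card_image)
    moreover have "graph_degree (graph_of n adj) v = card (nbrs ?E v)"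
      unfolding graph_degree_def using edges_at_eq_image_nbrs[of ?E v, OF two]
      by (simp add: card_image[OF inj_on_pair])
    ultimately show ?thesis by simp
  qed
  then show ?thesis
    using two sub by (simp add: regular_graphs_def simple_graph_def regular_def)
      (simp add: graph_of_def)
qed

section \<open>Circulant graphs\<close>

lemma inj_on_add_mod:
  "inj_on (\<lambda>k. (x + k) mod r) {..<r::nat}"
proof (rule linorder_inj_onI)
  fix k l assume kl: "k < l" "k \<in> {..<r}" "l \<in> {..<r}"
  show "(x + k) mod r \<noteq> (x + l) mod r"
  proof
    assume "(x + k) mod r = (x + l) mod r"
    then have "r dvd (x + l) - (x + k)" using kl by (metis add_le_cancel_left mod_eq_dvd_iff_nat less_imp_le)
    then have "r dvd l - k" by simp
    then show False using kl by (auto dest: dvd_imp_le)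
  qed
qed auto

text \<open>A circulant graph: residues modulo \<open>r\<close> are joined when they differ by an
  element of a connection set closed under \<open>k \<mapsto> r - k\<close>.\<close>

lemma ex_regular_adj:
  assumes r: "d < r" and ev: "even (d * r)"
  obtains adj :: "nat \<Rightarrow> nat \<Rightarrow> bool" where
    "\<And>x y. x < r \<Longrightarrow> y < r \<Longrightarrow> adj x y \<Longrightarrow> adj y x"
    "\<And>x. x < r \<Longrightarrow> \<not> adj x x"
    "\<And>x. x < r \<Longrightarrow> card {y. y < r \<and> adj x y} = d"
proof -
  define h where "h = d div 2"
  \<comment> \<open>\<open>h\<close> steps in either direction; for odd \<open>d\<close> the number
    \<open>r\<close> is even, and the self-inverse step \<open>r div 2\<close> supplies the last
    neighbour.\<close>
  define S where "S = {1..h} \<union> {r - h..<r} \<union> (if odd d then {r div 2} else {})"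
  define adj where "adj x y \<longleftrightarrow> (\<exists>k\<in>S. y = (x + k) mod r)" for x y
  have hr: "2 * h < r" using r by (auto simp: h_def)
  have odd: "2 * h + 1 < r \<and> 2 * (r div 2) = r" if "odd d"
    using that r ev by (auto simp: h_def)
  have Sr: "k \<in> S \<Longrightarrow> 0 < k \<and> k < r" for k
    using hr odd by (auto simp: S_def split: if_splits)
  have Ssym: "r - k \<in> S" if "k \<in> S" for k
    using that hr odd by (auto simp: S_def split: if_splits)
  have "card S = d"
  proof (cases "even d")
    case True
    have "card ({1..h} \<union> {r - h..<r}) = card {1..h} + card {r - h..<r}"
      using hr by (intro card_Un_disjoint) auto
    moreover have "h + h = d" using True unfolding h_def by presburger
    ultimately show ?thesis using True hr by (simp add: S_def)
  next
    case False
    have "card ({1..h} \<union> {r - h..<r} \<union> {r div 2}) = card ({1..h} \<union> {r - h..<r}) + card {r div 2}"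
      using hr odd[OF False] by (intro card_Un_disjoint) auto
    also have "card ({1..h} \<union> {r - h..<r}) = card {1..h} + card {r - h..<r}"
      using hr by (intro card_Un_disjoint) auto
    moreover have "h + h + 1 = d" using False unfolding h_def by presburger
    ultimately show ?thesis using False hr by (simp add: S_def)
  qed
  show ?thesis
  proof (rule that[of adj])
    fix x y assume xy: "x < r" "y < r" "adj x y"
    then obtain k where k: "k \<in> S" "y = (x + k) mod r" by (auto simp: adj_def)
    have "(y + (r - k)) mod r = (x + k + (r - k)) mod r"
      unfolding k(2) by (rule mod_add_left_eq)
    also have "\<dots> = x" using Sr[OF k(1)] xy by simp
    finally show "adj y x" using Ssym[OF k(1)] by (auto simp: adj_def)
  next
    fix x assume x: "x < r"
    show "\<not> adj x x"
    proof
      assume "adj x x"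
      then obtain k where k: "k \<in> S" "(x + 0) mod r = (x + k) mod r" using x by (auto simp: adj_def)
      then have "0 = k" using Sr[OF k(1)] by (intro inj_onD[OF inj_on_add_mod[of x r] k(2)]) auto
      then show False using Sr[OF k(1)] by simp
    qed
    have "{y. y < r \<and> adj x y} = (\<lambda>k. (x + k) mod r) ` S"
      using x by (auto simp: adj_def)
    moreover have "inj_on (\<lambda>k. (x + k) mod r) S"
      using inj_on_add_mod by (rule inj_on_subset) (use Sr in auto)
    ultimately show "card {y. y < r \<and> adj x y} = d" using \<open>card S = d\<close> by (simp add: card_image)
  qed
qed

text \<open>An \<open>m\<close>-fold lift of a complete graph: \<open>x div m\<close> is the fibre,
  \<open>x mod m\<close> the position in it, and \<open>p (j, i)\<close> with \<open>i < j\<close>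
  is the matching from fibre \<open>i\<close> to fibre \<open>j\<close>.\<close>

definition lift_adj :: "nat \<Rightarrow> (nat \<times> nat \<Rightarrow> nat \<Rightarrow> nat) \<Rightarrow> nat \<Rightarrow> nat \<Rightarrow> bool" where
  "lift_adj m p x y \<longleftrightarrow>
     (x div m < y div m \<and> p (y div m, x div m) (x mod m) = y mod m) \<or>
     (y div m < x div m \<and> p (x div m, y div m) (y mod m) = x mod m)"

lemma card_lift_adj:
  assumes p: "\<And>i j. i < j \<Longrightarrow> j \<le> d \<Longrightarrow> p (j, i) permutes {..<m}"
    and x: "x < m * (d + 1)"
  shows "card {y. y < m * (d + 1) \<and> lift_adj m p x y} = d"
proof -
  define i where "i = x div m"
  define a where "a = x mod m"
  have m: "0 < m" using x by (cases m) auto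
  have a: "a < m" using m by (simp add: a_def)
  have i: "i \<le> d" using x m by (simp add: i_def less_mult_imp_div_less mult.commute flip: less_Suc_eq_le)
  \<comment> \<open>Position of the only neighbour of \<open>x\<close> in fibre \<open>j\<close>;
    towards lower fibres the matching is read backwards.\<close>
  define t where "t j = (if i < j then p (j, i) a else inv (p (i, j)) a)" for j
  have tm: "t j < m" if "j \<le> d" "j \<noteq> i" for j
    using that a i p[of i j] p[of j i] permutes_in_image[of "p (j, i)" "{..<m}" a]
      permutes_in_image[OF permutes_inv, of "p (i, j)" "{..<m}" a]
    by (auto simp: t_def)
  have dm: "(m * j + t j) div m = j" "(m * j + t j) mod m = t j" if "j \<le> d" "j \<noteq> i" for j
    using tm[OF that] m by auto
  have "{y. y < m * (d + 1) \<and> lift_adj m p x y} = (\<lambda>j. m * j + t j) ` ({..d} - {i})"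
  proof (intro equalityI subsetI)
    fix y assume "y \<in> {y. y < m * (d + 1) \<and> lift_adj m p x y}"
    then have y: "y < m * (d + 1)" "lift_adj m p x y" by auto
    define j where "j = y div m"
    have j: "j \<le> d" using y m by (simp add: j_def less_mult_imp_div_less mult.commute flip: less_Suc_eq_le)
    have "(i < j \<and> p (j, i) a = y mod m) \<or> (j < i \<and> p (i, j) (y mod m) = a)"
      using y(2) by (simp add: lift_adj_def i_def a_def j_def)
    then have "j \<noteq> i \<and> y mod m = t j"
      using p[of j i] i by (auto simp: t_def permutes_inverses)
    moreover have "y = m * j + y mod m" by (simp add: j_def)
    ultimately show "y \<in> (\<lambda>j. m * j + t j) ` ({..d} - {i})" using j by auto
  next
    fix y assume "y \<in> (\<lambda>j. m * j + t j) ` ({..d} - {i})"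
    then obtain j where j: "j \<le> d" "j \<noteq> i" "y = m * j + t j" by auto
    have "y < m * j + m" using tm[OF j(1,2)] j(3) by simp
    also have "\<dots> \<le> m * (d + 1)" using j(1) by (metis add.commute mult_Suc_right mult_le_mono2 Suc_eq_plus1 Suc_le_mono)
    finally have "y < m * (d + 1)" .
    moreover have "lift_adj m p x y"
      using dm[OF j(1,2)] j p[of j i] i
      by (auto simp: lift_adj_def t_def permutes_inverses simp flip: i_def a_def)
    ultimately show "y \<in> {y. y < m * (d + 1) \<and> lift_adj m p x y}" by simp
  qed
  moreover have "inj_on (\<lambda>j. m * j + t j) ({..d} - {i})"
    by (rule inj_onI) (metis DiffD1 DiffD2 atMost_iff dm(1) singletonI)
  ultimately show ?thesis using i by (simp add: card_image)
qed

text \<open>The lifts of the complete graph on \<open>d + 1\<close> vertices, next to one fixed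
  \<open>d\<close>-regular graph on the remaining vertices, already account for \<open>n ^ (d * n / 2)\<close>
  regular graphs up to an exponential factor.\<close>

lemma card_regular_graphs_ge:
  assumes ev: "even (d * n)" and n: "m * (d + 1) + d < n"
  shows "fact m ^ (d * (d + 1) div 2) \<le> card (regular_graphs n d)"
proof -
  let ?M = "m * (d + 1)"
  define r where "r = n - ?M"
  \<comment> \<open>The remaining \<open>r > d\<close> vertices are to carry a circulant graph; its
    parity condition follows as \<open>d * (d + 1)\<close> is even.\<close>
  have "even (d * r)"
  proof -
    have "n = r + m * (d + 1)" using n by (simp add: r_def)
    then have "d * n = d * r + m * (d * (d + 1))" by (simp add: algebra_simps)
    moreover have "even (m * (d * (d + 1)))" by simp
    ultimately show ?thesis using ev by simp
  qed
  moreover have "d < r" using n by (simp add: r_def)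
  ultimately obtain circ :: "nat \<Rightarrow> nat \<Rightarrow> bool" where
    circ: "\<And>x y. x < r \<Longrightarrow> y < r \<Longrightarrow> circ x y \<Longrightarrow> circ y x"
      "\<And>x. x < r \<Longrightarrow> \<not> circ x x"
      "\<And>x. x < r \<Longrightarrow> card {y. y < r \<and> circ x y} = d"
    using ex_regular_adj by blast
  define adj where "adj p x y \<longleftrightarrow>
    (if x < ?M then y < ?M \<and> lift_adj m p x y else ?M \<le> y \<and> circ (x - ?M) (y - ?M))" for p x y
  define I where "I = (SIGMA j:{..d}. {..<j})"
  define P where "P = I \<rightarrow>\<^sub>E {q. q permutes {..<m}}"
  have symm: "adj p y x" if "x < n" "y < n" "adj p x y" for p x y
    using that circ(1)[of "x - ?M" "y - ?M"]
    by (auto simp: adj_def lift_adj_def r_def split: if_splits)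
  have reg: "graph_of n (adj p) \<in> regular_graphs n d" if p: "p \<in> P" for p
  proof (rule graph_of_regular)
    have perm: "p (j, i) permutes {..<m}" if "i < j" "j \<le> d" for i j
      using p that by (auto simp: P_def I_def PiE_iff)
    show "\<not> adj p x x" if "x < n" for x
      using that circ(2)[of "x - ?M"] by (auto simp: adj_def lift_adj_def r_def)
    show "card {y. y < n \<and> adj p x y} = d" if x: "x < n" for x
    proof (cases "x < ?M")
      case True
      then have "{y. y < n \<and> adj p x y} = {y. y < ?M \<and> lift_adj m p x y}"
        using n by (auto simp: adj_def)
      then show ?thesis using card_lift_adj[of d p m x] perm True by simp
    next
      case False
      have "{y. y < n \<and> adj p x y} = (+) ?M ` {y. y < r \<and> circ (x - ?M) y}"
      proof (intro equalityI subsetI)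
        fix y assume "y \<in> {y. y < n \<and> adj p x y}"
        then show "y \<in> (+) ?M ` {y. y < r \<and> circ (x - ?M) y}"
          using False by (intro image_eqI[of _ _ "y - ?M"]) (auto simp: adj_def r_def)
      qed (use False in \<open>auto simp: adj_def r_def\<close>)
      then show ?thesis using circ(3)[of "x - ?M"] x False by (simp add: card_image r_def)
    qed
  qed (rule symm)
  \<comment> \<open>The edges between the fibres \<open>i < j\<close> form the graph of
    \<open>p (j, i)\<close>, so they determine it.\<close>
  have "inj_on (\<lambda>p. graph_of n (adj p)) P"
  proof (rule inj_onI)
    fix p p' assume p: "p \<in> P" "p' \<in> P" and eq: "graph_of n (adj p) = graph_of n (adj p')"
    have adj_eq: "adj p x y \<longleftrightarrow> adj p' x y" if "x < n" "y < n" for x y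
      using edge_graph_of_iff[of n "adj p" x y] edge_graph_of_iff[of n "adj p'" x y] symm that eq by metis
    show "p = p'"
    proof (rule PiE_ext[OF p[unfolded P_def]])
      fix k assume "k \<in> I"
      then obtain i j where k: "k = (j, i)" "i < j" "j \<le> d" by (auto simp: I_def)
      have perm: "p (j, i) permutes {..<m}" "p' (j, i) permutes {..<m}"
        using p \<open>k \<in> I\<close> k(1) by (auto simp: P_def PiE_iff)
      have "p (j, i) a = p' (j, i) a" for a
      proof (cases "a < m")
        case True
        define b where "b = p (j, i) a"
        have b: "b < m" using permutes_in_image[OF perm(1), of a] True by (simp add: b_def)
        have lt: "m * l + c < ?M" if "l \<le> d" "c < m" for l c
        proof -
          have "m * l + c < m * Suc l" using that by simp
          also have "\<dots> \<le> ?M" using that by (intro mult_le_mono2) simp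
          finally show ?thesis .
        qed
        have "adj p (m * i + a) (m * j + b)"
          using lt[of i a] lt[of j b] k True b by (simp add: adj_def lift_adj_def b_def)
        then have "adj p' (m * i + a) (m * j + b)"
          using adj_eq lt[of i a] lt[of j b] k True b n by simp
        then show ?thesis
          using lt[of i a] k True b by (simp add: adj_def lift_adj_def b_def)
      next
        case False
        then show ?thesis using perm by (simp add: permutes_not_in)
      qed
      then show "p k = p' k" using k by auto
    qed
  qed
  moreover have "card P = fact m ^ (d * (d + 1) div 2)"
  proof -
    have "card I = (\<Sum>j\<le>d. j)" by (simp add: I_def)
    also have "\<dots> = d * (d + 1) div 2" using gauss_sum_nat[of d] by (simp add: atLeast0AtMost)
    finally have "card I = d * (d + 1) div 2" .
    moreover have "finite I" by (simp add: I_def)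
    ultimately show ?thesis by (simp add: P_def card_PiE card_permutations)
  qed
  ultimately show ?thesis
    using reg finite_regular_graphs card_inj_on_le[of "\<lambda>p. graph_of n (adj p)" P "regular_graphs n d"]
    by auto
qed

subsection \<open>Asymptotics\<close>

text \<open>\<open>m ^ m / fact m\<close> is a single term of the exponential series at
  \<open>m\<close>.\<close>

lemma power_le_fact_exp: "real m ^ m \<le> fact m * exp (real m)"
proof -
  have "(\<Sum>k\<in>{m}. real m ^ k /\<^sub>R fact k) \<le> exp (real m)"
    unfolding exp_def by (intro sum_le_suminf summable_exp_generic) auto
  then show ?thesis by (simp add: field_simps)
qed

text \<open>Puts \<open>fact m \<ge> (m / exp 1) ^ m\<close> into the count of lifts. The assumption
  on \<open>n\<close> makes \<open>n / (2 * (d + 1))\<close> at least 3, so that \<open>m\<close> is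
  at least this quantity and its logarithm is at least 1.\<close>

lemma exp_le_card_regular_graphs:
  assumes ev: "even (d * n)" and n: "real n \<ge> 6 * (real d + 1)"
  shows "exp ((real d / 2 * real n - real d * (real d + 1)) * (ln (real n) - (ln (2 * (real d + 1)) + 1)))
    \<le> real (card (regular_graphs n d))"
proof -
  \<comment> \<open>Giving up one vertex per fibre leaves at least \<open>d + 1\<close> vertices
    outside the lift, as \<open>card_regular_graphs_ge\<close> demands.\<close>
  define m where "m = n div (d + 1) - 1"
  define D where "D = d * (d + 1) div 2"
  have D: "real D = real d * (real d + 1) / 2"
  proof -
    have "2 * D = d * (d + 1)" unfolding D_def by simp
    then have "2 * real D = real d * (real d + 1)" by (metis of_nat_1 of_nat_add of_nat_mult of_nat_numeral)
    then show ?thesis by simp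
  qed
  have "real n \<ge> real (6 * (d + 1))" using n by simp
  then have n': "6 * (d + 1) \<le> n" by (simp only: of_nat_le_iff)
  have q: "6 \<le> n div (d + 1)" using div_le_mono[OF n', of "d + 1"] by (metis nonzero_mult_div_cancel_right add_is_0 one_neq_zero)
  have dm: "n = (d + 1) * (n div (d + 1)) + n mod (d + 1)" by (rule mult_div_mod_eq[symmetric])
  have md: "n mod (d + 1) < d + 1" by simp
  have mq: "n div (d + 1) = m + 1" using q by (simp add: m_def)
  have up: "m * (d + 1) + d < n" using dm unfolding mq by (simp add: algebra_simps)
  have "n < (d + 1) * (m + 2)"
  proof -
    have "(d + 1) * (m + 2) = (d + 1) * (m + 1) + (d + 1)" by simp
    then show ?thesis using dm[unfolded mq] md by linarith
  qed
  then have "real n < real ((d + 1) * (m + 2))" by (simp only: of_nat_less_iff)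
  then have m_ge: "real n / (real d + 1) - 2 \<le> real m" by (simp add: field_simps)
  have "2 * (real d + 1) * 3 \<le> real n" using n by simp
  then have n3: "3 \<le> real n / (2 * (real d + 1))" by (simp add: field_simps)
  have "z \<le> 2 * z - 2" if "3 \<le> z" for z :: real using that by linarith
  moreover have "2 * (real n / (2 * (real d + 1))) = real n / (real d + 1)" by (simp add: field_simps)
  ultimately have "real n / (2 * (real d + 1)) \<le> real n / (real d + 1) - 2" using n3 by metis
  with m_ge have m_ge': "real n / (2 * (real d + 1)) \<le> real m" by linarith
  have m3: "3 \<le> real m" using m_ge' n3 by linarith
  have n2: "2 \<le> real n / (real d + 1)" using n by (simp add: field_simps)
  have ln_n: "ln (real n / (2 * (real d + 1))) = ln (real n) - ln (2 * (real d + 1))"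
    using n by (intro ln_divide_pos) (auto intro: less_le_trans[OF _ n])
  have e3: "exp 1 \<le> (3::real)" by (rule exp_le)
  have ln1: "1 \<le> ln (real n / (2 * (real d + 1)))"
    using n3 e3 by (subst ln_ge_iff) (auto intro: order_trans less_le_trans[of 0 3])
  have ln2: "ln (real n / (2 * (real d + 1))) \<le> ln (real m)" using m_ge' n3 by simp
  have "(real d / 2 * real n - real d * (real d + 1)) = real D * (real n / (real d + 1) - 2)"
    unfolding D by (simp add: field_simps)
  also have "\<dots> * (ln (real n) - (ln (2 * (real d + 1)) + 1)) \<le> real D * real m * (ln (real m) - 1)"
    using m_ge ln1 ln2 ln_n n2 by (intro mult_mono) auto
  finally have "exp ((real d / 2 * real n - real d * (real d + 1)) * (ln (real n) - (ln (2 * (real d + 1)) + 1)))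
      \<le> exp (real D * real m * (ln (real m) - 1))" by simp
  also have "\<dots> = (real m ^ m / exp (real m)) ^ D"
  proof -
    have "exp (real m * (ln (real m) - 1)) = real m ^ m / exp (real m)"
      using m3 by (simp add: right_diff_distrib exp_diff exp_of_nat_mult)
    then show ?thesis by (simp add: mult.assoc exp_of_nat_mult)
  qed
  also have "\<dots> \<le> fact m ^ D"
    using power_le_fact_exp[of m] by (intro power_mono) (auto simp: field_simps)
  also have "\<dots> = real (fact m ^ D)" by simp
  also have "\<dots> \<le> real (card (regular_graphs n d))"
    unfolding of_nat_le_iff D_def by (rule card_regular_graphs_ge[OF ev up])
  finally show ?thesis .
qed

section \<open>Exceptional graphs are rare, and all others have large \<open>mu\<close>\<close>

lemma card_union_bad_le:
  assumes d: "d \<ge> 3" and n: "n \<ge> 1" and \<epsilon>: "\<epsilon> \<le> 1"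
    and \<eta>: "\<eta> \<le> \<epsilon> / (4 * (real d + 1))" "\<eta> \<le> 1 / (8 * real d ^ 3)"
  shows "real (card (triangle_rich n d \<union> partially_symmetric n d \<epsilon>))
    \<le> 2 * exp ((ln 16 + 1) * real n + (real d / 2 - \<eta>) * real n * ln (real n))"
proof -
  let ?B = "16 ^ n * real n powr ((real d / 2 - \<eta>) * real n) * exp (real n)"
  have mono: "real n powr ((real d / 2 - y) * real n) \<le> real n powr ((real d / 2 - \<eta>) * real n)"
    if "\<eta> \<le> y" for y
    using that n by (intro powr_mono mult_right_mono) auto
  have "real (card (triangle_rich n d)) \<le> 2 ^ n * real n powr ((real d / 2 - 1 / (8 * real d ^ 3)) * real n) * exp (real n)"
    using d n by (intro card_triangle_rich) auto
  also have "\<dots> \<le> ?B"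
    using mono[OF \<eta>(2)] by (intro mult_right_mono mult_mono power_mono) auto
  finally have 1: "real (card (triangle_rich n d)) \<le> ?B" .
  have "real (card (partially_symmetric n d \<epsilon>))
      \<le> 16 ^ n * real n powr ((real d / 2 - \<epsilon> / (4 * (real d + 1))) * real n) * exp (real n)"
    using d n \<epsilon> by (rule card_partially_symmetric)
  also have "\<dots> \<le> ?B" using mono[OF \<eta>(1)] by (intro mult_right_mono mult_left_mono) auto
  finally have 2: "real (card (partially_symmetric n d \<epsilon>)) \<le> ?B" .
  have "real (card (triangle_rich n d \<union> partially_symmetric n d \<epsilon>)) \<le> 2 * ?B"
    using 1 2 card_Un_le[of "triangle_rich n d" "partially_symmetric n d \<epsilon>"] by linarith
  also have "?B = exp ((ln 16 + 1) * real n + (real d / 2 - \<eta>) * real n * ln (real n))"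
    using n by (simp add: powr_def exp_add distrib_right mult.commute[of "ln 16"] exp_of_nat_mult)
  finally show ?thesis .
qed

text \<open>Let \<open>k = d + d ^ 2 + d ^ 3 + 1\<close>. More than half of the vertices avoid
  triangles, so the greedy choice gives \<open>card T \<ge> n / (2 * k)\<close>. For
  \<open>\<epsilon> = 1 / (32 * k)\<close> this lower bound equals
  \<open>16 * \<epsilon> * n\<close>, and a quarter of it is the exponent.\<close>

lemma mu_ge_if_not_bad:
  assumes G: "G \<in> regular_graphs n d"
    and nt: "G \<notin> triangle_rich n d"
    and ns: "G \<notin> partially_symmetric n d (1 / (32 * (real d + real d ^ 2 + real d ^ 3 + 1)))"
  shows "2 powr (1 / (8 * (real d + real d ^ 2 + real d ^ 3 + 1)) * real n) \<le> real (mu G)"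
proof -
  define E where "E = edges G"
  interpret regular_graph n d G E using G by unfold_locales (auto simp: E_def)
  define k where "k = real d + real d ^ 2 + real d ^ 3 + 1"
  have k0: "0 < k" unfolding k_def by (intro add_nonneg_pos add_nonneg_nonneg) auto
  define A where "A = {v \<in> {1..n}. \<not> in_triangle E v}"
  have "A \<subseteq> {1..n}" by (auto simp: A_def)
  then obtain T where T: "T \<subseteq> A" and far: "\<And>x y. x \<in> T \<Longrightarrow> y \<in> T \<Longrightarrow> x \<noteq> y \<Longrightarrow> y \<notin> near E x"
    and cT: "card A \<le> (d + d * d + d * d * d + 1) * card T"
    by (rule ex_far_apart) blast
  have sc: "scattered E T" using T far by (auto simp: scattered_def A_def)
  have Tn: "T \<subseteq> {1..n}" using T by (auto simp: A_def)
  have "\<not> n \<le> 2 * card {v \<in> {1..n}. in_triangle E v}"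
    using nt G unfolding triangle_rich_def E_def by blast
  moreover have "card {v \<in> {1..n}. in_triangle E v} + card A = n"
  proof -
    have "card ({v \<in> {1..n}. in_triangle E v} \<union> A) = card {v \<in> {1..n}. in_triangle E v} + card A"
      by (intro card_Un_disjoint) (auto simp: A_def)
    moreover have "{v \<in> {1..n}. in_triangle E v} \<union> A = {1..n}" by (auto simp: A_def)
    ultimately show ?thesis by simp
  qed
  ultimately have "n \<le> 2 * ((d + d * d + d * d * d + 1) * card T)" using cT by linarith
  then have "real n \<le> real (2 * ((d + d * d + d * d * d + 1) * card T))" by (simp only: of_nat_le_iff)
  then have nT: "real n \<le> 2 * k * real (card T)" by (simp add: k_def power2_eq_square power3_eq_cube algebra_simps)
  then have nT': "real n / (2 * k) \<le> real (card T)" using k0 by (simp add: field_simps)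
  have "16 * (1 / (32 * k)) * real n \<le> real (card T)" using nT' by simp
  then have "2 powr (real (card T) / 4) \<le> real (mu G)" by (rule mu_ge[OF sc Tn ns[folded k_def]])
  moreover have "2 powr (1 / (8 * k) * real n) \<le> 2 powr (real (card T) / 4)"
    using nT' by (intro powr_mono) auto
  ultimately show ?thesis unfolding k_def by linarith
qed

lemma prob_pmf_of_set_ge:
  assumes "finite R" "R \<noteq> {}" "finite B" "\<And>x. x \<in> R \<Longrightarrow> x \<notin> B \<Longrightarrow> P x"
  shows "1 - real (card B) / real (card R) \<le> measure_pmf.prob (pmf_of_set R) {x. P x}"
proof -
  have "R \<subseteq> (R \<inter> {x. P x}) \<union> B" using assms(4) by auto
  then have "card R \<le> card ((R \<inter> {x. P x}) \<union> B)" using assms by (intro card_mono) auto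
  also have "\<dots> \<le> card (R \<inter> {x. P x}) + card B" by (rule card_Un_le)
  finally have "real (card R) - real (card B) \<le> real (card (R \<inter> {x. P x}))" by linarith
  then have "(real (card R) - real (card B)) / real (card R) \<le> real (card (R \<inter> {x. P x})) / real (card R)"
    by (rule divide_right_mono) simp
  then show ?thesis using assms by (simp add: measure_pmf_of_set diff_divide_distrib)
qed

theorem theorem3:
  fixes d :: nat
  assumes "d \<ge> 3"
  shows "\<exists>c::real. c > 0 \<and> whp_regular d (\<lambda>n G. real (mu G) \<ge> 2 powr (c * real n))"
proof -
  define k where "k = real d + real d ^ 2 + real d ^ 3 + 1"
  define \<epsilon> where "\<epsilon> = 1 / (32 * k)"
  define c where "c = 1 / (8 * k)"
  define \<eta> where "\<eta> = min (\<epsilon> / (4 * (real d + 1))) (1 / (8 * real d ^ 3))"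
  define b where "b = real d * (real d + 1)"
  define l where "l = ln (2 * (real d + 1)) + 1"
  \<comment> \<open>Quotient of the bound on exceptional graphs by the lower bound on all regular
    graphs. The main terms \<open>d / 2 * n * ln n\<close> cancel, and
    \<open>- \<eta> * n * ln n\<close> outweighs the rest.\<close>
  define err where "err n = 2 * exp (- \<eta> * real n * ln (real n) + (ln 16 + 1 + real d / 2 * l) * real n
    + b * ln (real n) - b * l)" for n
  have k1: "1 \<le> k" by (simp add: k_def)
  have \<epsilon>: "0 < \<epsilon>" "\<epsilon> \<le> 1"
    using k1 by (auto simp: \<epsilon>_def field_simps)
  have \<eta>: "0 < \<eta>" using \<epsilon> assms by (auto simp: \<eta>_def)
  have lim: "err \<longlonglongrightarrow> 0"
  proof -
    have "((\<lambda>n. 2 * exp (- \<eta> * real n * ln (real n) + a * real n + b * ln (real n) - e)) \<longlongrightarrow> 0) sequentially"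
      for a e :: real
      using \<eta> by real_asymp
    then show ?thesis unfolding err_def .
  qed
  have bound: "1 - err n \<le> measure_pmf.prob (random_regular_graph n d) {G. 2 powr (c * real n) \<le> real (mu G)}"
    if ev: "even (d * n)" and n: "6 * (real d + 1) \<le> real n" for n
  proof -
    let ?R = "regular_graphs n d" and ?B = "triangle_rich n d \<union> partially_symmetric n d \<epsilon>"
    let ?L = "exp ((real d / 2 * real n - b) * (ln (real n) - l))"
    have n1: "1 \<le> n" using n by (cases n) auto
    have L: "?L \<le> real (card ?R)" using exp_le_card_regular_graphs[OF ev n] by (simp add: b_def l_def)
    \<comment> \<open>The lower bound also yields nonemptiness, without which
      \<open>pmf_of_set\<close> has no meaning.\<close>
    have "0 < real (card ?R)" using L by (rule less_le_trans[OF exp_gt_zero])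
    then have ne: "?R \<noteq> {}" by auto
    have "real (card ?B) \<le> 2 * exp ((ln 16 + 1) * real n + (real d / 2 - \<eta>) * real n * ln (real n))"
      using assms n1 \<epsilon> by (intro card_union_bad_le) (auto simp: \<eta>_def)
    then have "real (card ?B) / real (card ?R)
        \<le> 2 * exp ((ln 16 + 1) * real n + (real d / 2 - \<eta>) * real n * ln (real n)) / ?L"
      using L by (intro frac_le) auto
    also have "\<dots> = err n"
      unfolding err_def times_divide_eq_right[symmetric] exp_diff[symmetric]
      by (intro arg_cong[of _ _ "\<lambda>x. 2 * exp x"]) (simp add: field_simps)
    finally have "1 - err n \<le> 1 - real (card ?B) / real (card ?R)" by simp
    also have "\<dots> \<le> measure_pmf.prob (pmf_of_set ?R) {G. 2 powr (c * real n) \<le> real (mu G)}"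
    proof (rule prob_pmf_of_set_ge[OF finite_regular_graphs ne])
      show "finite ?B"
        by (rule finite_subset[OF _ finite_regular_graphs[of n d]])
          (auto simp: triangle_rich_def partially_symmetric_def)
      show "2 powr (c * real n) \<le> real (mu G)" if "G \<in> ?R" "G \<notin> ?B" for G
        using mu_ge_if_not_bad[of G n d] that by (simp add: c_def \<epsilon>_def k_def)
    qed
    finally show ?thesis by (simp add: random_regular_graph_def)
  qed
  let ?F = "inf sequentially (principal {n. even (d * n)})"
  have "whp_regular d (\<lambda>n G. real (mu G) \<ge> 2 powr (c * real n))"
    unfolding whp_regular_def
  proof (rule tendsto_sandwich[of "\<lambda>n. 1 - err n" _ ?F "\<lambda>_. 1"])
    have "\<forall>\<^sub>F n in sequentially. 6 * (real d + 1) \<le> real n" by real_asymp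
    then show "\<forall>\<^sub>F n in ?F. 1 - err n
        \<le> measure_pmf.prob (random_regular_graph n d) {G. 2 powr (c * real n) \<le> real (mu G)}"
      unfolding eventually_inf_principal by eventually_elim (use bound in auto)
    have "(\<lambda>n. 1 - err n) \<longlonglongrightarrow> 1 - 0" by (intro tendsto_diff tendsto_const lim)
    then show "((\<lambda>n. 1 - err n) \<longlongrightarrow> 1) ?F" by (simp add: tendsto_mono[OF inf_le1])
  qed auto
  moreover have "0 < c" using k1 by (simp add: c_def)
  ultimately show ?thesis by blast
qed

end
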